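(* Let $N,\nu\in\mathbb{R}$. For every positive integer $M$, the following hold as $z\to\infty$ ($z$ real): \[ F_\nu^N(z)=z^{-1}e^{-z}\sum_{s=0}^{M-1}\left[\sum_{j+r=s}a_j\,\Gamma(r+1/2)\sum_{k+l=r}b_{k,N}\, c_{l,j}\right] z^{-s}+O(z^{-1-M}e^{-z}), \] \[ G_\nu^N(z)=z^{-2}e^{-z}\sum_{s=0}^{M-1}\left[\sum_{j+r=s}a_j\,\Gamma(r+3/2)\sum_{k+l=r}d_{k,N}\, c_{l,j}\right] z^{-s}+O(z^{-2-M}e^{-z}). \] Here the inner sums run over non-negative integers $j,r$ with $j+r=s$ and non-negative integers $k,l$ with $k+l=r$.
   Context: For $z>0$ and $\nu\in\mathbb{R}$, the modified Bessel function of the second kind is $K_\nu(z)=\int_0^\infty \exp(-z\cosh t)\cosh(\nu t)\,dt$. Define, for $z>0$, \[ F_\nu^N(z)=\int_0^\infty \cosh^N(t)\, K_\nu(z\cosh t)\, dt,\qquad G_\nu^N(z)=\int_0^\infty \cosh^N(t)\, K_\nu(z\cosh t)\sinh^2(t)\, dt . \] The coefficients are: - $a_j=\sqrt{\dfrac{\pi}{2}}\;\dfrac{\prod_{l=1}^j\left(4\nu^2-(2l-1)^2\right)}{8^j\, j!}$ for $j\ge0$ (empty product $=1$); these are the coefficients in the classical expansion $K_\nu(x)=x^{-1/2}e^{-x}\big[\sum_{j=0}^{k-1}a_jx^{-j}+O(x^{-k})\big]$ as $x\to\infty$; - $b_{j,N}=g_N^{(j)}(0)/j!$, the Taylor coefficients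 at $x=0$ of $g_N(x)=\dfrac{(x+1)^N}{\sqrt{x+2}}$; - $d_{j,N}=h_N^{(j)}(0)/j!$, the Taylor coefficients at $x=0$ of $h_N(x)=\sqrt{x+2}\,(x+1)^N$; - $c_{l,j}=\dfrac{(-1/2-j)(-1/2-j-1)\cdots(-1/2-j-(l-1))}{l!}$, the Taylor coefficients at $x=0$ of $(x+1)^{-1/2-j}=\sum_{l\ge0} c_{l,j}x^l$ (with $c_{0,j}=1$). *)

theory Defs
  imports "HOL-Analysis.Analysis" "HOL-Library.Landau_Symbols"
begin

text \<open>
  Real powers of positive reals are written with \<open>powr\<close>.  All definitions in which an
  argument \<open>z\<close> occurs are meant for \<open>z > 0\<close>, where the integrals converge absolutely.
\<close>

definition Bessel_K :: "real \<Rightarrow> real \<Rightarrow> real" where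
  "Bessel_K \<nu> z = (LBINT t:{0..}. exp (- z * cosh t) * cosh (\<nu> * t))"

definition F :: "real \<Rightarrow> real \<Rightarrow> real \<Rightarrow> real" where
  "F \<nu> N z = (LBINT t:{0..}. cosh t powr N * Bessel_K \<nu> (z * cosh t))"

definition G :: "real \<Rightarrow> real \<Rightarrow> real \<Rightarrow> real" where
  "G \<nu> N z = (LBINT t:{0..}. cosh t powr N * Bessel_K \<nu> (z * cosh t) * (sinh t)\<^sup>2)"

definition coeff_a :: "real \<Rightarrow> nat \<Rightarrow> real" where
  "coeff_a \<nu> j =
     sqrt (pi / 2) * ((\<Prod>l=1..j. 4 * \<nu>\<^sup>2 - (2 * real l - 1)\<^sup>2) / (8 ^ j * fact j))"

definition taylor_coeff :: "(real \<Rightarrow> real) \<Rightarrow> nat \<Rightarrow> real" where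
  "taylor_coeff f j = (deriv ^^ j) f 0 / fact j"

definition coeff_b :: "nat \<Rightarrow> real \<Rightarrow> real" where
  "coeff_b j N = taylor_coeff (\<lambda>x. (x + 1) powr N / sqrt (x + 2)) j"

definition coeff_d :: "nat \<Rightarrow> real \<Rightarrow> real" where
  "coeff_d j N = taylor_coeff (\<lambda>x. sqrt (x + 2) * (x + 1) powr N) j"

definition coeff_c :: "nat \<Rightarrow> nat \<Rightarrow> real" where
  "coeff_c l j = (\<Prod>i<l. - 1/2 - real j - real i) / fact l"

end

theory Submission
  imports Defs
begin

text \<open>
  Put \<open>s = cosh t - 1\<close>. Then \<open>cosh (t/2) = sqrt (1 + s/2)\<close> and \<open>ds = sqrt 2 * sqrt s * cosh (t/2) dt\<close>,
  so that a half-angle factor in the integrand absorbs everything in \<open>dt\<close> but a power of \<open>s\<close>: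
  \<open>exp (- z * s) * s ^ n * cosh (t/2)\<close> integrates over \<open>t \<ge> 0\<close> to the pure Gamma term
  \<open>Gamma (n + 1/2) * z powr (- n - 1/2) / sqrt 2\<close> (\<open>hyperbolic_moment\<close>). Every integral in the
  proof has the form \<open>exp (- z) \<integral> exp (- z * s) * f t dt\<close> where, near \<open>t = 0\<close>,
  \<open>f t = P s * cosh (t/2)\<close> for a convergent power series \<open>P\<close> (\<open>hyperbolic_expansion\<close>). Integrating
  termwise with a remainder gives a Watson lemma that is uniform in \<open>z \<ge> 1\<close>
  (\<open>watson_hyperbolic\<close>).

  This lemma is used twice. With \<open>f t = cosh (\<nu> * t)\<close> it yields the classical expansion of the Bessel
  function with an error bound valid for all \<open>x \<ge> 1\<close> (\<open>Bessel_K_asymptotics\<close>). The power series \<open>W\<close> of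
  \<open>cosh (\<nu> * t) / cosh (t/2)\<close> is identified through its companion \<open>V\<close>, the series of
  \<open>sinh (\<nu> * t) / sinh (t/2)\<close>: differentiating the two products in \<open>t\<close> shows that both factorizations
  hold as soon as \<open>(s + 2) W' + W/2 = \<nu> V\<close> and \<open>s V' + V/2 = \<nu> W\<close>, and these two equations amount
  to the recurrence satisfied by the coefficients \<open>a\<close>.

  Since \<open>z * cosh t \<ge> 1\<close> whenever \<open>z \<ge> 1\<close>, the expansion of the Bessel function may be inserted under
  the integral sign. Its \<open>j\<close>-th term leaves the weight \<open>w t\<close> times \<open>cosh t powr (- 1/2 - j)\<close>, that is
  \<open>(1 + s) powr (- 1/2 - j)\<close>, and Watson's lemma applies again; the product of power series
  accounts for the convolution of the Taylor coefficients. Expanding the \<open>j\<close>-th term only to order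
  \<open>M - j\<close> produces exactly the triangle \<open>j + r < M\<close>
  (\<open>weighted_Bessel_K_asymptotics\<close>). The two integrals belong to the weights \<open>cosh t powr N\<close> and
  \<open>cosh t powr N * (sinh t)\<^sup>2\<close>; because \<open>(sinh t)\<^sup>2 = s * (s + 2)\<close>, the series of the second one starts
  with a factor \<open>s\<close>, which costs one power of \<open>z\<close> and shifts the Gamma arguments by \<open>1\<close>.
\<close>

section \<open>Moments of the exponential weight in hyperbolic coordinates\<close>

lemma borel_measurable_cosh [measurable (raw)]:
  fixes f :: "'a \<Rightarrow> real"
  assumes "f \<in> borel_measurable M"
  shows "(\<lambda>x. cosh (f x)) \<in> borel_measurable M"
  by (rule measurable_compose[OF assms]) (intro borel_measurable_continuous_onI continuous_intros)

lemma borel_measurable_sinh [measurable (raw)]: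
  fixes f :: "'a \<Rightarrow> real"
  assumes "f \<in> borel_measurable M"
  shows "(\<lambda>x. sinh (f x)) \<in> borel_measurable M"
  by (rule measurable_compose[OF assms]) (intro borel_measurable_continuous_onI continuous_intros)

lemma set_integral_sum_finite:
  fixes f :: "'i \<Rightarrow> 'a \<Rightarrow> 'b :: {banach, second_countable_topology}"
  assumes "\<And>i. i \<in> I \<Longrightarrow> set_integrable M A (f i)"
  shows "set_integrable M A (\<lambda>x. \<Sum>i\<in>I. f i x)"
    and "(LINT x:A|M. \<Sum>i\<in>I. f i x) = (\<Sum>i\<in>I. LINT x:A|M. f i x)"
  using assms unfolding set_integrable_def set_lebesgue_integral_def
  by (simp_all add: scaleR_sum_right)

text \<open>
  The substitution \<open>x = z * (cosh t - 1)\<close> turns Euler's integral for \<open>Gamma (n + 1/2)\<close> into a multiple of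
  this integral: \<open>x powr (n - 1/2)\<close> contains \<open>1 / (sqrt 2 * sinh (t/2))\<close>, which cancels against
  \<open>sinh t = 2 * sinh (t/2) * cosh (t/2)\<close> from \<open>dx\<close>.
\<close>

lemma hyperbolic_moment:
  fixes z :: real and n :: nat
  assumes "z > 0"
  shows "set_integrable lborel {0..} (\<lambda>t. exp (- z * (cosh t - 1)) * ((cosh t - 1) ^ n * cosh (t / 2)))"
    and "(LBINT t:{0..}. exp (- z * (cosh t - 1)) * ((cosh t - 1) ^ n * cosh (t / 2))) =
           Gamma (real n + 1/2) * z powr (- real n - 1/2) / sqrt 2"
proof -
  define \<alpha> where "\<alpha> = real n + 1/2"
  define g where "g = (\<lambda>t. z * (cosh t - 1))"
  define f where "f = (\<lambda>x::real. x powr (\<alpha> - 1) / exp x)"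
  define c where "c = sqrt 2 * z powr \<alpha>"
  let ?h = "\<lambda>t. exp (- z * (cosh t - 1)) * ((cosh t - 1) ^ n * cosh (t / 2))"
  have "\<alpha> > 0" and "c > 0" using assms by (simp_all add: \<alpha>_def c_def)
  have inj: "inj_on g {0<..}"
    using assms by (auto simp: inj_on_def g_def)
  have img: "g ` {0<..} = {0<..}"
  proof -
    have "y \<in> g ` {0<..}" if "y > 0" for y
    proof (rule image_eqI)
      show "y = g (arcosh (1 + y / z))" "arcosh (1 + y / z) \<in> {0<..}"
        using that assms by (simp_all add: g_def field_simps)
    qed
    moreover have "g t > 0" if "t > 0" for t
      using that assms cosh_real_strict_mono[of 0 t] by (simp add: g_def)
    ultimately show ?thesis by blast
  qed
  have der: "(g has_field_derivative z * sinh t) (at t within {0<..})" for t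
    unfolding g_def by (auto intro!: derivative_eq_intros)
  have "(f has_integral Gamma \<alpha>) {0..}"
    unfolding f_def by (rule Gamma_integral_real) fact
  hence I: "(f has_integral Gamma \<alpha>) {0<..}"
    by (subst has_integral_spike_set_eq[where T = "{0..}"]) (auto intro: negligible_subset[of "{0}"])
  have "f absolutely_integrable_on g ` {0<..} \<and> integral (g ` {0<..}) f = Gamma \<alpha>"
    using I nonnegative_absolutely_integrable_1[of f "{0<..}"]
    by (auto simp: img f_def has_integral_iff)
  hence *: "(\<lambda>t. \<bar>z * sinh t\<bar> * f (g t)) absolutely_integrable_on {0<..} \<and>
        integral {0<..} (\<lambda>t. \<bar>z * sinh t\<bar> * f (g t)) = Gamma \<alpha>"
    by (subst has_absolute_integral_change_of_variables_1'[OF _ der inj]) auto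
  have eq: "\<bar>z * sinh t\<bar> * f (g t) = c * ?h t" if "t > 0" for t
  proof -
    have s: "sinh (t/2) > 0" using that by simp
    have ch: "cosh t - 1 = 2 * (sinh (t/2))\<^sup>2"
      using cosh_double_cosh[of "t/2"] by (simp add: cosh_square_eq)
    have sh: "sinh t = 2 * sinh (t/2) * cosh (t/2)"
      using sinh_double[of "t/2"] by simp
    have pos: "cosh t - 1 > 0" using ch s by simp
    have rt: "(cosh t - 1) powr (1/2) = sqrt 2 * sinh (t/2)"
      using s pos by (simp add: powr_half_sqrt ch real_sqrt_mult)
    have "(cosh t - 1) powr (\<alpha> - 1) = (cosh t - 1) powr (real n - 1/2)"
      by (simp add: \<alpha>_def)
    also have "\<dots> = (cosh t - 1) ^ n / (sqrt 2 * sinh (t/2))"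
      using pos rt by (simp only: powr_diff powr_realpow)
    finally have p: "(cosh t - 1) powr (\<alpha> - 1) = (cosh t - 1) ^ n / (sqrt 2 * sinh (t/2))" .
    have zp: "z * z powr (\<alpha> - 1) = z powr \<alpha>"
      using assms by (simp add: powr_mult_base)
    have "\<bar>z * sinh t\<bar> * f (g t) = (z * z powr (\<alpha> - 1)) * (sinh t * (cosh t - 1) powr (\<alpha> - 1)) * exp (- g t)"
    proof -
      have "(z * (cosh t - 1)) powr (\<alpha> - 1) = z powr (\<alpha> - 1) * (cosh t - 1) powr (\<alpha> - 1)"
        using assms pos by (simp add: powr_mult)
      thus ?thesis using assms that by (simp add: f_def g_def exp_minus divide_inverse mult_ac)
    qed
    also have "sinh t * (cosh t - 1) powr (\<alpha> - 1) = sqrt 2 * ((cosh t - 1) ^ n * cosh (t/2))"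
      unfolding p sh using s by (simp add: field_simps)
    finally show ?thesis
      unfolding zp by (simp add: c_def g_def algebra_simps)
  qed
  have "(\<lambda>t. \<bar>z * sinh t\<bar> * f (g t)) absolutely_integrable_on {0<..} \<longleftrightarrow>
          (\<lambda>t. c * ?h t) absolutely_integrable_on {0<..}"
    by (rule set_integrable_cong) (auto simp: eq)
  with * have "(\<lambda>t. (1 / c) * (c * ?h t)) absolutely_integrable_on {0<..}"
    by (intro set_integrable_mult_right) auto
  also have "(\<lambda>t. (1 / c) * (c * ?h t)) = ?h"
    using \<open>c > 0\<close> by auto
  also have "?h absolutely_integrable_on {0<..} \<longleftrightarrow> ?h absolutely_integrable_on {0..}"
    by (rule absolutely_integrable_spike_set_eq) (auto intro: negligible_subset[of "{0}"])
  finally have "set_integrable lebesgue {0..} ?h" .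
  hence int: "set_integrable lborel {0..} ?h"
    unfolding set_integrable_def by (subst (asm) integrable_completion) auto
  thus "set_integrable lborel {0..} ?h" .
  have "integral {0<..} (\<lambda>t. \<bar>z * sinh t\<bar> * f (g t)) = integral {0<..} (\<lambda>t. c * ?h t)"
    by (rule Henstock_Kurzweil_Integration.integral_cong) (simp add: eq)
  also have "\<dots> = c * integral {0<..} ?h" by simp
  also have "integral {0<..} ?h = integral {0..} ?h"
    by (rule integral_spike_set) (auto intro: negligible_subset[of "{0}"])
  finally have "c * integral {0..} ?h = Gamma \<alpha>" using * by simp
  moreover have "(LBINT t:{0..}. ?h t) = integral {0..} ?h"
    by (rule set_borel_integral_eq_integral(2)) (rule int)
  ultimately have "(LBINT t:{0..}. ?h t) = Gamma \<alpha> / c"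
    using \<open>c > 0\<close> by (simp add: field_simps)
  also have "\<dots> = Gamma \<alpha> * z powr (- \<alpha>) / sqrt 2"
    by (simp add: c_def powr_minus field_simps)
  also have "- \<alpha> = - real n - 1/2" by (simp add: \<alpha>_def)
  finally show "(LBINT t:{0..}. ?h t) = Gamma (real n + 1/2) * z powr (- real n - 1/2) / sqrt 2"
    by (simp add: \<alpha>_def)
qed

section \<open>A Watson lemma\<close>

text \<open>
  The remainder is \<open>x ^ M\<close> times the shifted power series, which is continuous and hence bounded near \<open>0\<close>.
\<close>

lemma eval_fps_remainder_bound:
  fixes P :: "real fps"
  assumes "fps_conv_radius P > 0"
  shows "\<exists>K \<delta>. K \<ge> 0 \<and> \<delta> > 0 \<and> (\<forall>x. \<bar>x\<bar> < \<delta> \<longrightarrow>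
           \<bar>eval_fps P x - (\<Sum>n<M. fps_nth P n * x ^ n)\<bar> \<le> K * \<bar>x\<bar> ^ M)"
proof -
  let ?Q = "fps_shift M P"
  have Q: "fps_conv_radius ?Q > 0" using assms by simp
  have "isCont (eval_fps ?Q) 0"
    using Q by (intro continuous_eval_fps) (auto simp: zero_ereal_def)
  then obtain d where d: "d > 0" "\<And>x. dist x 0 < d \<Longrightarrow> dist (eval_fps ?Q x) (eval_fps ?Q 0) < 1"
    using zero_less_one unfolding continuous_at_eps_delta by blast
  obtain r :: real where r: "r > 0" "ereal r < fps_conv_radius P"
    using ereal_dense2[OF assms] by (auto simp: zero_ereal_def)
  define K where "K = \<bar>eval_fps ?Q 0\<bar> + 1"
  show ?thesis
  proof (intro exI conjI allI impI)
    show "K \<ge> 0" "min d r > 0" using d r by (auto simp: K_def)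
    fix x :: real assume x: "\<bar>x\<bar> < min d r"
    have "ereal (norm x) < fps_conv_radius P"
      using x r by (metis ereal_less_eq(3) less_imp_le min.strict_boundedE order_le_less_trans real_norm_def)
    hence sm: "summable (\<lambda>n. fps_nth P n * x ^ n)" by (rule summable_fps)
    have "eval_fps P x = (\<Sum>n. fps_nth P (n + M) * x ^ (n + M)) + (\<Sum>n<M. fps_nth P n * x ^ n)"
      unfolding eval_fps_def by (rule suminf_split_initial_segment[OF sm])
    also have "(\<Sum>n. fps_nth P (n + M) * x ^ (n + M)) = (\<Sum>n. x ^ M * (fps_nth P (n + M) * x ^ n))"
      by (simp add: power_add mult_ac)
    also have "\<dots> = x ^ M * eval_fps ?Q x"
    proof -
      have "ereal (norm x) < fps_conv_radius ?Q" using \<open>ereal (norm x) < _\<close> by simp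
      from summable_fps[OF this] show ?thesis
        unfolding eval_fps_def by (subst suminf_mult) (simp_all add: fps_shift_nth)
    qed
    finally have "eval_fps P x - (\<Sum>n<M. fps_nth P n * x ^ n) = x ^ M * eval_fps ?Q x" by simp
    moreover have "\<bar>eval_fps ?Q x\<bar> \<le> K"
      using d(2)[of x] x by (simp add: K_def dist_real_def)
    ultimately show "\<bar>eval_fps P x - (\<Sum>n<M. fps_nth P n * x ^ n)\<bar> \<le> K * \<bar>x\<bar> ^ M"
      using mult_right_mono[of "\<bar>eval_fps ?Q x\<bar>" K "\<bar>x\<bar> ^ M"]
      by (simp add: abs_mult power_abs mult.commute)
  qed
qed

text \<open>
  The class of integrands to which Watson's lemma applies. The factor \<open>cosh (t/2)\<close> is split off so that the
  terms of the series have the moments computed above; growth is measured in powers of \<open>cosh t\<close> so that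
  the class is closed under multiplication by real powers of \<open>cosh t\<close>.
\<close>

definition hyperbolic_expansion :: "(real \<Rightarrow> real) \<Rightarrow> real fps \<Rightarrow> bool" where
  "hyperbolic_expansion f P \<longleftrightarrow>
     f \<in> borel_measurable borel \<and>
     (\<exists>C (B::nat). \<forall>t\<ge>0. \<bar>f t\<bar> \<le> C * cosh t ^ B) \<and>
     fps_conv_radius P > 0 \<and>
     eventually (\<lambda>t. f t = eval_fps P (cosh t - 1) * cosh (t / 2)) (at_right 0)"

text \<open>
  Near \<open>0\<close> this is the remainder bound for power series. Away from \<open>0\<close>, where \<open>cosh t - 1 \<ge> s0 > 0\<close>, the
  factor \<open>((cosh t - 1) / s0) ^ M\<close> is at least \<open>1\<close> and can be multiplied onto crude growth bounds. Bounding
  \<open>cosh t ^ B\<close> by \<open>2 ^ B * (1 + (cosh t - 1) ^ B)\<close> leaves a majorant built from two of the functions whose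
  moments are known exactly.
\<close>

lemma hyperbolic_expansion_remainder:
  assumes "hyperbolic_expansion f P"
  shows "\<exists>C B. C \<ge> 0 \<and> (\<forall>t>0. \<bar>f t - (\<Sum>n<M. fps_nth P n * ((cosh t - 1) ^ n * cosh (t / 2)))\<bar>
           \<le> C * ((cosh t - 1) ^ M * cosh (t / 2) + (cosh t - 1) ^ (M + B) * cosh (t / 2)))"
proof -
  let ?S = "\<lambda>t. \<Sum>n<M. fps_nth P n * (cosh t - 1) ^ n"
  from assms obtain C0 and B0 :: nat where growth: "\<And>t. t \<ge> 0 \<Longrightarrow> \<bar>f t\<bar> \<le> C0 * cosh t ^ B0"
    and rad: "fps_conv_radius P > 0"
    and ev: "eventually (\<lambda>t. f t = eval_fps P (cosh t - 1) * cosh (t / 2)) (at_right 0)"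
    unfolding hyperbolic_expansion_def by blast
  have "C0 \<ge> 0" using growth[of 0] by simp
  obtain K \<delta> where K: "K \<ge> 0" "\<delta> > 0" "\<And>x. \<bar>x\<bar> < \<delta> \<Longrightarrow>
      \<bar>eval_fps P x - (\<Sum>n<M. fps_nth P n * x ^ n)\<bar> \<le> K * \<bar>x\<bar> ^ M"
    using eval_fps_remainder_bound[OF rad, of M] by blast
  have "((\<lambda>t::real. cosh t - 1) \<longlongrightarrow> cosh 0 - 1) (at_right 0)"
    by (intro tendsto_intros)
  hence "eventually (\<lambda>t::real. cosh t - 1 < \<delta>) (at_right 0)"
    using K by (intro order_tendstoD) simp_all
  with ev have "eventually (\<lambda>t. f t = eval_fps P (cosh t - 1) * cosh (t / 2) \<and> cosh t - 1 < \<delta>) (at_right 0)"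
    by eventually_elim auto
  then obtain t0 where t0: "t0 > 0" "\<And>t. 0 < t \<Longrightarrow> t < t0 \<Longrightarrow>
      f t = eval_fps P (cosh t - 1) * cosh (t / 2) \<and> cosh t - 1 < \<delta>"
    unfolding eventually_at_right_field by auto
  define s0 where "s0 = cosh t0 - 1"
  have "s0 > 0" using cosh_real_strict_mono[of 0 t0] t0 by (simp add: s0_def)
  define A where "A = (\<Sum>n<M. \<bar>fps_nth P n\<bar>)"
  have "A \<ge> 0" unfolding A_def by (rule sum_nonneg) simp
  define B where "B = B0 + M"
  define D where "D = K + (C0 + A) / s0 ^ M"
  have "D \<ge> 0" using K \<open>C0 \<ge> 0\<close> \<open>A \<ge> 0\<close> \<open>s0 > 0\<close> by (simp add: D_def)
  have bound: "\<bar>f t - ?S t * cosh (t / 2)\<bar> \<le> D * (cosh t - 1) ^ M * cosh t ^ B * cosh (t / 2)"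
    if "t > 0" for t
  proof (cases "t < t0")
    case True
    have s: "cosh t - 1 \<ge> 0" using cosh_real_ge_1[of t] by simp
    have "\<bar>f t - ?S t * cosh (t / 2)\<bar> = \<bar>eval_fps P (cosh t - 1) - ?S t\<bar> * cosh (t / 2)"
      using t0(2)[OF that True] by (simp add: left_diff_distrib[symmetric] abs_mult)
    also have "\<dots> \<le> (K * (cosh t - 1) ^ M) * cosh (t / 2)"
      using K(3)[of "cosh t - 1"] t0(2)[OF that True] s by (intro mult_right_mono) auto
    also have "\<dots> \<le> (D * (cosh t - 1) ^ M * cosh t ^ B) * cosh (t / 2)"
    proof (rule mult_right_mono)
      have "K \<le> D" using \<open>C0 \<ge> 0\<close> \<open>A \<ge> 0\<close> \<open>s0 > 0\<close> by (simp add: D_def)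
      have "K * (cosh t - 1) ^ M * 1 \<le> D * (cosh t - 1) ^ M * cosh t ^ B"
        using \<open>K \<le> D\<close> \<open>D \<ge> 0\<close> s by (intro mult_mono one_le_power cosh_real_ge_1) auto
      thus "K * (cosh t - 1) ^ M \<le> D * (cosh t - 1) ^ M * cosh t ^ B" by simp
    qed simp
    finally show ?thesis .
  next
    case False
    have c1: "cosh t \<ge> 1" by (rule cosh_real_ge_1)
    have c2: "cosh (t / 2) \<ge> 1" by (rule cosh_real_ge_1)
    have s: "cosh t - 1 \<ge> s0"
      using False t0 by (simp add: s0_def cosh_real_nonneg_le_iff)
    hence one: "1 \<le> (cosh t - 1) ^ M / s0 ^ M"
      using \<open>s0 > 0\<close> by (simp add: power_mono)
    have "\<bar>?S t\<bar> \<le> (\<Sum>n<M. \<bar>fps_nth P n\<bar> * cosh t ^ M)"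
    proof (rule order.trans[OF sum_abs sum_mono])
      fix n assume "n \<in> {..<M}"
      have "(cosh t - 1) ^ n \<le> cosh t ^ n" using c1 by (intro power_mono) auto
      also have "\<dots> \<le> cosh t ^ M" using c1 \<open>n \<in> _\<close> by (intro power_increasing) auto
      finally show "\<bar>fps_nth P n * (cosh t - 1) ^ n\<bar> \<le> \<bar>fps_nth P n\<bar> * cosh t ^ M"
        using c1 by (simp add: abs_mult mult_left_mono)
    qed
    also have "\<dots> = A * cosh t ^ M" by (simp add: A_def sum_distrib_right)
    also have "\<dots> \<le> A * cosh t ^ B"
      using c1 \<open>A \<ge> 0\<close> by (intro mult_left_mono power_increasing) (auto simp: B_def)
    finally have S: "\<bar>?S t\<bar> \<le> A * cosh t ^ B" .
    have "\<bar>f t\<bar> \<le> C0 * cosh t ^ B0" using that by (intro growth) auto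
    also have "\<dots> \<le> C0 * cosh t ^ B"
      using c1 \<open>C0 \<ge> 0\<close> by (intro mult_left_mono power_increasing) (auto simp: B_def)
    also have "\<dots> \<le> C0 * cosh t ^ B * cosh (t / 2)"
      using mult_left_mono[OF c2, of "C0 * cosh t ^ B"] c1 \<open>C0 \<ge> 0\<close> by simp
    finally have f: "\<bar>f t\<bar> \<le> C0 * cosh t ^ B * cosh (t / 2)" .
    have "\<bar>f t - ?S t * cosh (t / 2)\<bar> \<le> \<bar>f t\<bar> + \<bar>?S t\<bar> * cosh (t / 2)"
      using abs_triangle_ineq4[of "f t" "?S t * cosh (t / 2)"] by (simp add: abs_mult)
    also have "\<dots> \<le> C0 * cosh t ^ B * cosh (t / 2) + A * cosh t ^ B * cosh (t / 2)"
      using S f by (intro add_mono mult_right_mono) auto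
    also have "\<dots> = 1 * ((C0 + A) * cosh t ^ B * cosh (t / 2))"
      by (simp add: algebra_simps)
    also have "\<dots> \<le> (cosh t - 1) ^ M / s0 ^ M * ((C0 + A) * cosh t ^ B * cosh (t / 2))"
      using one \<open>C0 \<ge> 0\<close> \<open>A \<ge> 0\<close> c1 by (intro mult_right_mono) auto
    also have "\<dots> = (C0 + A) / s0 ^ M * ((cosh t - 1) ^ M * cosh t ^ B * cosh (t / 2))"
      by simp
    also have "\<dots> \<le> D * ((cosh t - 1) ^ M * cosh t ^ B * cosh (t / 2))"
      using \<open>K \<ge> 0\<close> c1 by (intro mult_right_mono) (auto simp: D_def)
    finally show ?thesis by (simp add: mult.assoc)
  qed
  show ?thesis
  proof (intro exI conjI allI impI)
    show "D * 2 ^ B \<ge> 0" using \<open>D \<ge> 0\<close> by simp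
    fix t :: real assume "t > 0"
    have c1: "cosh t \<ge> 1" by (rule cosh_real_ge_1)
    have "cosh t ^ B \<le> 2 ^ B * (1 + (cosh t - 1) ^ B)"
    proof (cases "cosh t \<le> 2")
      case True
      hence "cosh t ^ B \<le> 2 ^ B * 1" using c1 by (simp add: power_mono)
      also have "\<dots> \<le> 2 ^ B * (1 + (cosh t - 1) ^ B)"
        using c1 by (intro mult_left_mono) auto
      finally show ?thesis .
    next
      case False
      hence "cosh t ^ B \<le> (2 * (cosh t - 1)) ^ B" by (intro power_mono) auto
      also have "\<dots> = 2 ^ B * (cosh t - 1) ^ B" by (rule power_mult_distrib)
      also have "\<dots> \<le> 2 ^ B * (1 + (cosh t - 1) ^ B)" by (intro mult_left_mono) auto
      finally show ?thesis .
    qed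
    hence "D * (cosh t - 1) ^ M * cosh t ^ B * cosh (t / 2) \<le>
        D * (cosh t - 1) ^ M * (2 ^ B * (1 + (cosh t - 1) ^ B)) * cosh (t / 2)"
      using \<open>D \<ge> 0\<close> c1 by (intro mult_right_mono mult_left_mono) auto
    also have "\<dots> = D * 2 ^ B * ((cosh t - 1) ^ M * cosh (t / 2) + (cosh t - 1) ^ (M + B) * cosh (t / 2))"
      by (simp add: algebra_simps power_add)
    finally have "\<bar>f t - ?S t * cosh (t / 2)\<bar> \<le> \<dots>"
      using bound[OF \<open>t > 0\<close>] by linarith
    thus "\<bar>f t - (\<Sum>n<M. fps_nth P n * ((cosh t - 1) ^ n * cosh (t / 2)))\<bar> \<le>
        D * 2 ^ B * ((cosh t - 1) ^ M * cosh (t / 2) + (cosh t - 1) ^ (M + B) * cosh (t / 2))"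
      by (simp add: sum_distrib_right mult.assoc)
  qed
qed

text \<open>
  The finite partial sum is integrated exactly and the majorant of the remainder contributes moments of
  orders \<open>M\<close> and \<open>M + B\<close>; for \<open>z \<ge> 1\<close> the second one is dominated by \<open>z powr (- M - 1/2)\<close> as well. The bound
  holds on the whole of \<open>z \<ge> 1\<close>, not just eventually, which is what allows \<open>z * cosh t\<close> to be
  substituted for the argument later.
\<close>

lemma watson_hyperbolic:
  assumes "hyperbolic_expansion f P"
  shows "\<exists>D. \<forall>z\<ge>1. set_integrable lborel {0..} (\<lambda>t. exp (- z * (cosh t - 1)) * f t) \<and>
           \<bar>(LBINT t:{0..}. exp (- z * (cosh t - 1)) * f t) -
             (\<Sum>n<M. fps_nth P n * (Gamma (real n + 1/2) * z powr (- real n - 1/2) / sqrt 2))\<bar>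
             \<le> D * z powr (- real M - 1/2)"
proof -
  let ?m = "\<lambda>n t. (cosh t - 1) ^ n * cosh (t / 2) :: real"
  let ?e = "\<lambda>z t. exp (- z * (cosh t - 1)) :: real"
  let ?I = "\<lambda>n z. Gamma (real n + 1/2) * z powr (- real n - 1/2) / sqrt 2"
  define R where "R = (\<lambda>t. f t - (\<Sum>n<M. fps_nth P n * ?m n t))"
  from assms have f [measurable]: "f \<in> borel_measurable borel" by (simp add: hyperbolic_expansion_def)
  have R_meas [measurable]: "R \<in> borel_measurable borel" unfolding R_def by measurable
  from hyperbolic_expansion_remainder[OF assms, of M] obtain C B where C: "C \<ge> 0"
    and R: "\<And>t. t > 0 \<Longrightarrow> \<bar>R t\<bar> \<le> C * (?m M t + ?m (M + B) t)"
    unfolding R_def by blast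
  define D where "D = C * (Gamma (real M + 1/2) + Gamma (real (M + B) + 1/2)) / sqrt 2"
  show ?thesis
  proof (intro exI allI impI)
    fix z :: real assume z: "z \<ge> 1"
    note mom = hyperbolic_moment[of z]
    let ?g = "\<lambda>t. C * (?e z t * ?m M t) + C * (?e z t * ?m (M + B) t)"
    have int_g: "set_integrable lborel {0..} ?g"
      using z by (intro set_integral_add set_integrable_mult_right mom) auto
    have AE: "AE t in lborel. t \<in> {0..} \<longrightarrow> norm (?e z t * R t) \<le> ?g t"
      using AE_lborel_singleton[of 0]
    proof eventually_elim
      case (elim t)
      show ?case
      proof
        assume "t \<in> {0..}"
        with elim have "t > 0" by simp
        from mult_left_mono[OF R[OF this], of "?e z t"]
        show "norm (?e z t * R t) \<le> ?g t" by (simp add: abs_mult algebra_simps)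
      qed
    qed
    have int_R: "set_integrable lborel {0..} (\<lambda>t. ?e z t * R t)"
      using int_g
    proof (rule set_integrable_bound)
      show "set_borel_measurable lborel {0..} (\<lambda>t. ?e z t * R t)"
        unfolding set_borel_measurable_def by measurable
      show "AE t in lborel. t \<in> {0..} \<longrightarrow> norm (?e z t * R t) \<le> norm (?g t)"
        using AE by eventually_elim auto
    qed
    have int_m: "set_integrable lborel {0..} (\<lambda>t. fps_nth P n * (?e z t * ?m n t))" for n
      using z by (intro set_integrable_mult_right mom) auto
    have int_sum: "set_integrable lborel {0..} (\<lambda>t. \<Sum>n<M. fps_nth P n * (?e z t * ?m n t))"
      by (intro set_integral_sum_finite int_m)
    have split: "?e z t * f t = (\<Sum>n<M. fps_nth P n * (?e z t * ?m n t)) + ?e z t * R t" for t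
      by (simp add: R_def right_diff_distrib sum_distrib_left mult_ac)
    have int_f: "set_integrable lborel {0..} (\<lambda>t. ?e z t * f t)"
      unfolding split by (intro set_integral_add int_sum int_R)
    have "(LBINT t:{0..}. ?e z t * f t) =
        (LBINT t:{0..}. \<Sum>n<M. fps_nth P n * (?e z t * ?m n t)) + (LBINT t:{0..}. ?e z t * R t)"
      unfolding split by (intro set_integral_add int_sum int_R)
    also have "(LBINT t:{0..}. \<Sum>n<M. fps_nth P n * (?e z t * ?m n t)) =
        (\<Sum>n<M. LBINT t:{0..}. fps_nth P n * (?e z t * ?m n t))"
      by (intro set_integral_sum_finite int_m)
    also have "\<dots> = (\<Sum>n<M. fps_nth P n * ?I n z)"
    proof (rule sum.cong[OF refl])
      fix n
      show "(LBINT t:{0..}. fps_nth P n * (?e z t * ?m n t)) = fps_nth P n * ?I n z"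
        using mom(2)[of n] z by (subst set_integral_mult_right) simp
    qed
    finally have diff: "(LBINT t:{0..}. ?e z t * f t) - (\<Sum>n<M. fps_nth P n * ?I n z) =
        (LBINT t:{0..}. ?e z t * R t)" by simp
    have "\<bar>LBINT t:{0..}. ?e z t * R t\<bar> \<le> (LBINT t:{0..}. \<bar>?e z t * R t\<bar>)"
      using set_integral_norm_bound[OF int_R] by simp
    also have "\<dots> \<le> (LBINT t:{0..}. ?g t)"
      using AE by (intro set_integral_mono_AE set_integrable_abs int_R int_g) auto
    also have "\<dots> = C * ?I M z + C * ?I (M + B) z"
    proof -
      have int: "set_integrable lborel {0..} (\<lambda>t. C * (?e z t * ?m n t))"
        and val: "(LBINT t:{0..}. C * (?e z t * ?m n t)) = C * ?I n z" for n
        using mom[of n] z by (simp_all only: set_integrable_mult_right set_integral_mult_right)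
      show ?thesis
        by (subst set_integral_add(2)[OF int int]) (simp only: val)
    qed
    also have "\<dots> \<le> D * z powr (- real M - 1/2)"
    proof -
      have "Gamma (real (M + B) + 1/2) * z powr (- real (M + B) - 1/2) \<le>
          Gamma (real (M + B) + 1/2) * z powr (- real M - 1/2)"
        using z by (intro mult_left_mono powr_mono) (auto intro!: less_imp_le Gamma_real_pos)
      hence "C / sqrt 2 * (Gamma (real M + 1/2) * z powr (- real M - 1/2) +
            Gamma (real (M + B) + 1/2) * z powr (- real (M + B) - 1/2)) \<le>
          C / sqrt 2 * (Gamma (real M + 1/2) * z powr (- real M - 1/2) +
            Gamma (real (M + B) + 1/2) * z powr (- real M - 1/2))"
        using C by (intro mult_left_mono add_left_mono) auto
      thus ?thesis by (simp add: D_def distrib_left distrib_right add_divide_distrib mult.assoc)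
    qed
    finally show "set_integrable lborel {0..} (\<lambda>t. ?e z t * f t) \<and>
        \<bar>(LBINT t:{0..}. ?e z t * f t) - (\<Sum>n<M. fps_nth P n * ?I n z)\<bar>
          \<le> D * z powr (- real M - 1/2)"
      using int_f unfolding diff by blast
  qed
qed

section \<open>The classical expansion of the Bessel function\<close>

text \<open>
  The series of \<open>cosh (\<nu> * t) / cosh (t/2)\<close> in powers of \<open>cosh t - 1\<close>, with coefficients normalized such
  that Watson's lemma turns them into the coefficients \<open>a\<close>.
\<close>

definition bessel_fps :: "real \<Rightarrow> real fps" where
  "bessel_fps \<nu> = Abs_fps (\<lambda>n. sqrt 2 * coeff_a \<nu> n / Gamma (real n + 1/2))"

lemma bessel_fps_0: "fps_nth (bessel_fps \<nu>) 0 = 1"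
  by (simp add: bessel_fps_def coeff_a_def Gamma_one_half_real real_sqrt_divide)

lemma bessel_fps_Suc:
  "real (Suc n) * (2 * real n + 1) * fps_nth (bessel_fps \<nu>) (Suc n) =
     (\<nu>\<^sup>2 - (real n + 1/2)\<^sup>2) * fps_nth (bessel_fps \<nu>) n"
proof -
  have G: "Gamma (real (Suc n) + 1/2) = (real n + 1/2) * Gamma (real n + 1/2)"
  proof -
    have "real n + 1/2 \<notin> \<int>\<^sub>\<le>\<^sub>0"
      by (auto dest: nonpos_Ints_nonpos)
    from Gamma_plus1[OF this] show ?thesis by (simp add: add_ac)
  qed
  have pos: "Gamma (real n + 1/2) > 0" by (intro Gamma_real_pos) auto
  have a: "coeff_a \<nu> (Suc n) = (4 * \<nu>\<^sup>2 - (2 * real n + 1)\<^sup>2) / (8 * real (Suc n)) * coeff_a \<nu> n"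
    by (simp add: coeff_a_def prod.nat_ivl_Suc' algebra_simps)
  have cancel: "p * q * (sqrt 2 * ((4 * v - q\<^sup>2) / (8 * p) * c) / (q / 2 * g)) = (v - (q / 2)\<^sup>2) * (sqrt 2 * c / g)"
    if "p > 0" "q > 0" "g > 0" for p q g v c :: real
    using that by (simp add: field_simps power2_eq_square)
  have half: "real n + 1/2 = (2 * real n + 1) / 2" by simp
  show ?thesis
    unfolding bessel_fps_def fps_nth_Abs_fps G a
    using cancel[OF _ _ pos, of "real (Suc n)" "2 * real n + 1" "\<nu>\<^sup>2" "coeff_a \<nu> n"]
    by (simp only: half)
qed

lemma bessel_fps_bound: "\<bar>fps_nth (bessel_fps \<nu>) n\<bar> \<le> (\<nu>\<^sup>2 + 1) ^ n"
proof (induction n)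
  case 0
  show ?case by (simp add: bessel_fps_0)
next
  case (Suc n)
  define d where "d = real (Suc n) * (2 * real n + 1)"
  have d: "d \<ge> 1" by (simp add: d_def algebra_simps)
  have "d * \<bar>fps_nth (bessel_fps \<nu>) (Suc n)\<bar> = \<bar>\<nu>\<^sup>2 - (real n + 1/2)\<^sup>2\<bar> * \<bar>fps_nth (bessel_fps \<nu>) n\<bar>"
    using arg_cong[OF bessel_fps_Suc[of n \<nu>, folded d_def], of abs] d by (simp add: abs_mult)
  also have "\<dots> \<le> (d * (\<nu>\<^sup>2 + 1)) * (\<nu>\<^sup>2 + 1) ^ n"
  proof (intro mult_mono Suc.IH)
    have "\<bar>\<nu>\<^sup>2 - (real n + 1/2)\<^sup>2\<bar> \<le> \<nu>\<^sup>2 + (real n + 1/2)\<^sup>2"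
      by (simp add: abs_le_iff)
    also have "(real n + 1/2)\<^sup>2 \<le> d"
      by (simp add: d_def power2_eq_square algebra_simps)
    also have "\<nu>\<^sup>2 + d \<le> d * (\<nu>\<^sup>2 + 1)"
      using mult_right_mono[OF d, of "\<nu>\<^sup>2"] by (simp add: algebra_simps)
    finally show "\<bar>\<nu>\<^sup>2 - (real n + 1/2)\<^sup>2\<bar> \<le> d * (\<nu>\<^sup>2 + 1)" by simp
  qed (use d in auto)
  finally have "d * \<bar>fps_nth (bessel_fps \<nu>) (Suc n)\<bar> \<le> d * (\<nu>\<^sup>2 + 1) ^ Suc n"
    by (simp add: mult_ac)
  thus ?case using d by simp
qed

lemma fps_conv_radius_pos_of_geometric_bound:
  fixes P :: "real fps"
  assumes "\<And>n. \<bar>fps_nth P n\<bar> \<le> C * L ^ n" and "L > 0"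
  shows "fps_conv_radius P > 0"
proof -
  have "summable (\<lambda>n. fps_nth P n * (1 / (2 * L)) ^ n)"
  proof (rule summable_comparison_test)
    show "\<exists>N. \<forall>n\<ge>N. norm (fps_nth P n * (1 / (2 * L)) ^ n) \<le> C * (1/2) ^ n"
    proof (intro exI allI impI)
      fix n
      have "norm (fps_nth P n * (1 / (2 * L)) ^ n) \<le> C * L ^ n * (1 / (2 * L)) ^ n"
        unfolding real_norm_def abs_mult using assms(2)
        by (intro mult_mono assms(1) order.trans[OF abs_ge_zero assms(1)]) auto
      also have "\<dots> = C * (1/2) ^ n"
        using assms(2) by (simp add: power_divide power_mult_distrib)
      finally show "norm (fps_nth P n * (1 / (2 * L)) ^ n) \<le> C * (1/2) ^ n" .
    qed
    show "summable (\<lambda>n. C * (1/2 :: real) ^ n)"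
      by (intro summable_mult summable_geometric) auto
  qed
  from conv_radius_geI[OF this] have "ereal (norm (1 / (2 * L))) \<le> fps_conv_radius P"
    by (simp add: fps_conv_radius_def)
  moreover have "0 < ereal (norm (1 / (2 * L)))"
    using assms(2) by (simp add: zero_ereal_def)
  ultimately show ?thesis by (rule less_le_trans[rotated])
qed

text \<open>
  The combinations \<open>(Y + Z) * exp (- \<nu> * t)\<close> and \<open>(Y - Z) * exp (\<nu> * t)\<close> have derivative \<open>0\<close>.
\<close>

lemma half_angle_system_unique:
  fixes \<nu> T :: real and Y Z :: "real \<Rightarrow> real"
  assumes Y: "\<And>t. \<bar>t\<bar> < T \<Longrightarrow> (Y has_field_derivative \<nu> * Z t) (at t)"
    and Z: "\<And>t. \<bar>t\<bar> < T \<Longrightarrow> (Z has_field_derivative \<nu> * Y t) (at t)"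
    and init: "Y 0 = 1" "Z 0 = 0" and t: "\<bar>t\<bar> < T"
  shows "Y t = cosh (\<nu> * t)"
proof -
  have "(Y t + Z t) * exp (- \<nu> * t) = (Y 0 + Z 0) * exp (- \<nu> * 0)"
    using t by (intro DERIV_isconst3[of "-T" T])
      (auto intro!: derivative_eq_intros Y Z simp: algebra_simps)
  hence 1: "Y t + Z t = exp (\<nu> * t)"
    by (simp add: init exp_minus field_simps)
  have "(Y t - Z t) * exp (\<nu> * t) = (Y 0 - Z 0) * exp (\<nu> * 0)"
    using t by (intro DERIV_isconst3[of "-T" T])
      (auto intro!: derivative_eq_intros Y Z simp: algebra_simps)
  hence 2: "Y t - Z t = exp (- (\<nu> * t))"
    by (simp add: init exp_minus field_simps)
  from 1 2 show ?thesis by (simp add: cosh_field_def)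
qed

text \<open>
  With \<open>s = cosh t - 1\<close>, set \<open>Y = W s * cosh (t/2)\<close> and \<open>Z = V s * sinh (t/2)\<close>. Since
  \<open>sinh t = 2 * sinh (t/2) * cosh (t/2)\<close>, \<open>s + 2 = 2 * (cosh (t/2))\<^sup>2\<close> and \<open>s = 2 * (sinh (t/2))\<^sup>2\<close>, the equations
  \<open>(s + 2) W' + W/2 = \<nu> V\<close> and \<open>s V' + V/2 = \<nu> W\<close> say precisely that \<open>Y' = \<nu> Z\<close> and \<open>Z' = \<nu> Y\<close>. On
  coefficients, the second equation defines \<open>V\<close> from \<open>W\<close>, and the first one is then the recurrence
  \<open>bessel_fps_Suc\<close>.
\<close>

lemma cosh_eq_bessel_fps:
  "\<exists>T>0. \<forall>t. \<bar>t\<bar> < T \<longrightarrow>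
     cosh (\<nu> * t) = eval_fps (bessel_fps \<nu>) (cosh t - 1) * cosh (t / 2)"
proof -
  define W where "W = bessel_fps \<nu>"
  define V where "V = Abs_fps (\<lambda>n. \<nu> * fps_nth W n / (real n + 1/2))"
  have W_rad: "fps_conv_radius W > 0"
    unfolding W_def using bessel_fps_bound[of \<nu>]
    by (intro fps_conv_radius_pos_of_geometric_bound[of _ 1 "\<nu>\<^sup>2 + 1"]) (auto simp: add_nonneg_pos)
  have V_rad: "fps_conv_radius V > 0"
  proof (rule fps_conv_radius_pos_of_geometric_bound[of _ "2 * \<bar>\<nu>\<bar>" "\<nu>\<^sup>2 + 1"])
    fix n
    have "\<bar>fps_nth V n\<bar> = \<bar>\<nu>\<bar> * \<bar>fps_nth W n\<bar> * (1 / (real n + 1/2))"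
      by (simp add: V_def abs_mult)
    also have "\<dots> \<le> \<bar>\<nu>\<bar> * (\<nu>\<^sup>2 + 1) ^ n * 2"
      unfolding W_def by (intro mult_mono bessel_fps_bound) (auto simp: field_simps)
    finally show "\<bar>fps_nth V n\<bar> \<le> 2 * \<bar>\<nu>\<bar> * (\<nu>\<^sup>2 + 1) ^ n" by (simp add: mult_ac)
  qed (auto simp: add_nonneg_pos)
  have V_nth: "(real n + 1/2) * fps_nth V n = \<nu> * fps_nth W n" for n
    by (simp add: V_def)
  have W_nth: "2 * (real n + 1) * fps_nth W (Suc n) + (real n + 1/2) * fps_nth W n = \<nu> * fps_nth V n" for n
  proof -
    have "(real n + 1/2) * (2 * (real n + 1) * fps_nth W (Suc n) + (real n + 1/2) * fps_nth W n)
        = real (Suc n) * (2 * real n + 1) * fps_nth W (Suc n) + (real n + 1/2)\<^sup>2 * fps_nth W n"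
      by (simp add: algebra_simps power2_eq_square)
    also have "real (Suc n) * (2 * real n + 1) * fps_nth W (Suc n) =
        (\<nu>\<^sup>2 - (real n + 1/2)\<^sup>2) * fps_nth W n"
      unfolding W_def by (rule bessel_fps_Suc)
    also have "\<dots> + (real n + 1/2)\<^sup>2 * fps_nth W n = \<nu>\<^sup>2 * fps_nth W n"
      by (simp add: left_diff_distrib)
    also have "\<dots> = (real n + 1/2) * (\<nu> * fps_nth V n)"
      using V_nth[of n] by (simp add: power2_eq_square)
    finally show ?thesis by (subst (asm) mult_left_cancel) auto
  qed
  have W_ode: "(fps_X + 2) * fps_deriv W + fps_const (1/2) * W = fps_const \<nu> * V"
  proof (rule fps_ext)
    fix n
    show "fps_nth ((fps_X + 2) * fps_deriv W + fps_const (1/2) * W) n = fps_nth (fps_const \<nu> * V) n"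
      using W_nth[of n] by (cases n) (simp_all add: algebra_simps numeral_fps_const)
  qed
  have V_ode: "fps_X * fps_deriv V + fps_const (1/2) * V = fps_const \<nu> * W"
  proof (rule fps_ext)
    fix n
    show "fps_nth (fps_X * fps_deriv V + fps_const (1/2) * V) n = fps_nth (fps_const \<nu> * W) n"
      using V_nth[of n] by (cases n) (simp_all add: algebra_simps)
  qed
  obtain r where r: "r > 0" "ereal r < min (fps_conv_radius W) (fps_conv_radius V)"
    using ereal_dense2[of 0 "min (fps_conv_radius W) (fps_conv_radius V)"] W_rad V_rad
    by (auto simp: zero_ereal_def)
  have inW: "ereal (norm x) < fps_conv_radius W" and inV: "ereal (norm x) < fps_conv_radius V"
    if "\<bar>x\<bar> < r" for x :: real
  proof -
    have "ereal (norm x) < ereal r" using that by simp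
    also note r(2)
    finally show "ereal (norm x) < fps_conv_radius W" "ereal (norm x) < fps_conv_radius V" by auto
  qed
  have inW': "ereal (norm x) < fps_conv_radius (fps_deriv W)"
    and inV': "ereal (norm x) < fps_conv_radius (fps_deriv V)" if "\<bar>x\<bar> < r" for x :: real
    using inW[OF that] inV[OF that] fps_conv_radius_deriv[of W] fps_conv_radius_deriv[of V]
    by (auto intro: less_le_trans)
  have W_eq: "(x + 2) * eval_fps (fps_deriv W) x + eval_fps W x / 2 = \<nu> * eval_fps V x"
    if x: "\<bar>x\<bar> < r" for x :: real
  proof -
    have X2: "fps_conv_radius (fps_X + 2 :: real fps) = \<infinity>"
      using fps_conv_radius_add[of "fps_X :: real fps" 2] by simp
    have r1: "ereal (norm x) < fps_conv_radius ((fps_X + 2) * fps_deriv W)"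
      using fps_conv_radius_mult[of "fps_X + 2" "fps_deriv W"] inW'[OF x] X2 by (auto intro: less_le_trans)
    have r2: "ereal (norm x) < fps_conv_radius (fps_const (1/2) * W)"
      using inW[OF x] by (simp add: fps_conv_radius_cmult_left)
    have "eval_fps ((fps_X + 2) * fps_deriv W + fps_const (1/2) * W) x = eval_fps (fps_const \<nu> * V) x"
      by (simp only: W_ode)
    thus ?thesis
      using r1 r2 x inW[OF x] inW'[OF x] inV[OF x] X2
      by (simp add: eval_fps_add eval_fps_mult)
  qed
  have V_eq: "x * eval_fps (fps_deriv V) x + eval_fps V x / 2 = \<nu> * eval_fps W x"
    if x: "\<bar>x\<bar> < r" for x :: real
  proof -
    have r1: "ereal (norm x) < fps_conv_radius (fps_X * fps_deriv V)"
      using fps_conv_radius_mult[of "fps_X" "fps_deriv V"] inV'[OF x] by (auto intro: less_le_trans)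
    have r2: "ereal (norm x) < fps_conv_radius (fps_const (1/2) * V)"
      using inV[OF x] by (cases "\<nu> = 0") (simp_all add: fps_conv_radius_cmult_left)
    have "eval_fps (fps_X * fps_deriv V + fps_const (1/2) * V) x = eval_fps (fps_const \<nu> * W) x"
      by (simp only: V_ode)
    thus ?thesis
      using r1 r2 x inW[OF x] inV'[OF x] inV[OF x]
      by (simp add: eval_fps_add eval_fps_mult)
  qed
  have "((\<lambda>t::real. cosh t - 1) \<longlongrightarrow> cosh 0 - 1) (nhds 0)"
    using isCont_cosh[of "0::real"] by (intro tendsto_diff tendsto_const) (auto simp: isCont_def tendsto_nhds_iff)
  hence "eventually (\<lambda>t::real. cosh t - 1 < r) (nhds 0)"
    using r by (intro order_tendstoD) simp_all
  then obtain T where T: "T > 0" "\<And>t. \<bar>t\<bar> < T \<Longrightarrow> cosh t - 1 < r"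
    unfolding eventually_nhds_metric by (auto simp: dist_real_def)
  hence sr: "\<bar>cosh t - 1\<bar> < r" if "\<bar>t\<bar> < T" for t
    using that cosh_real_ge_1[of t] by simp
  define Y where "Y = (\<lambda>t. eval_fps W (cosh t - 1) * cosh (t / 2))"
  define Z where "Z = (\<lambda>t. eval_fps V (cosh t - 1) * sinh (t / 2))"
  have ch: "cosh t = 2 * (cosh (t/2))\<^sup>2 - 1" for t :: real
    using cosh_double_cosh[of "t/2"] by simp
  have ch': "cosh t = 2 * (sinh (t/2))\<^sup>2 + 1" for t :: real
    using ch[of t] by (simp add: cosh_square_eq)
  have sh: "sinh t = 2 * sinh (t/2) * cosh (t/2)" for t :: real
    using sinh_double[of "t/2"] by simp
  have dW: "(eval_fps W has_field_derivative eval_fps (fps_deriv W) (cosh t - 1)) (at (cosh t - 1))"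
    if "\<bar>t\<bar> < T" for t
    using inW[OF sr[OF that]] by (intro has_field_derivative_eval_fps) auto
  have dV: "(eval_fps V has_field_derivative eval_fps (fps_deriv V) (cosh t - 1)) (at (cosh t - 1))"
    if "\<bar>t\<bar> < T" for t
    using inV[OF sr[OF that]] by (intro has_field_derivative_eval_fps) auto
  have dcosh: "((\<lambda>t::real. cosh t - 1) has_field_derivative sinh t) (at t)" for t
    by (auto intro!: derivative_eq_intros)
  have Y': "(Y has_field_derivative \<nu> * Z t) (at t)" if t: "\<bar>t\<bar> < T" for t
  proof -
    let ?w = "eval_fps W (cosh t - 1)" and ?w' = "eval_fps (fps_deriv W) (cosh t - 1)"
    have "(Y has_field_derivative ?w' * sinh t * cosh (t / 2) + ?w * (sinh (t / 2) / 2)) (at t)"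
      unfolding Y_def using DERIV_chain2[OF dW[OF t] dcosh]
      by (auto intro!: derivative_eq_intros)
    also have "?w' * sinh t * cosh (t / 2) + ?w * (sinh (t / 2) / 2) =
        ((cosh t - 1 + 2) * ?w' + ?w / 2) * sinh (t / 2)"
      unfolding ch[of t] sh[of t] by (simp add: algebra_simps power2_eq_square)
    also have "\<dots> = \<nu> * Z t"
      using W_eq[OF sr[OF t]] by (simp add: Z_def)
    finally show ?thesis .
  qed
  have Z': "(Z has_field_derivative \<nu> * Y t) (at t)" if t: "\<bar>t\<bar> < T" for t
  proof -
    let ?v = "eval_fps V (cosh t - 1)" and ?v' = "eval_fps (fps_deriv V) (cosh t - 1)"
    have "(Z has_field_derivative ?v' * sinh t * sinh (t / 2) + ?v * (cosh (t / 2) / 2)) (at t)"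
      unfolding Z_def using DERIV_chain2[OF dV[OF t] dcosh]
      by (auto intro!: derivative_eq_intros)
    also have "?v' * sinh t * sinh (t / 2) + ?v * (cosh (t / 2) / 2) =
        ((cosh t - 1) * ?v' + ?v / 2) * cosh (t / 2)"
      unfolding ch'[of t] sh[of t] by (simp add: algebra_simps power2_eq_square)
    also have "\<dots> = \<nu> * Y t"
      using V_eq[OF sr[OF t]] by (simp add: Y_def)
    finally show ?thesis .
  qed
  have "Y 0 = 1" "Z 0 = 0"
    by (simp_all add: Y_def Z_def eval_fps_at_0 W_def bessel_fps_0)
  from half_angle_system_unique[of T Y \<nu> Z, OF Y' Z' this]
  show ?thesis using T(1) unfolding Y_def W_def by metis
qed

lemma hyperbolic_expansion_cosh: "hyperbolic_expansion (\<lambda>t. cosh (\<nu> * t)) (bessel_fps \<nu>)"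
  unfolding hyperbolic_expansion_def
proof (intro conjI)
  show "(\<lambda>t. cosh (\<nu> * t)) \<in> borel_measurable borel" by measurable
  show "fps_conv_radius (bessel_fps \<nu>) > 0"
    using bessel_fps_bound[of \<nu>]
    by (intro fps_conv_radius_pos_of_geometric_bound[of _ 1 "\<nu>\<^sup>2 + 1"]) (auto simp: add_nonneg_pos)
  obtain T where T: "T > 0" "\<And>t. \<bar>t\<bar> < T \<Longrightarrow>
      cosh (\<nu> * t) = eval_fps (bessel_fps \<nu>) (cosh t - 1) * cosh (t / 2)"
    using cosh_eq_bessel_fps[of \<nu>] by blast
  thus "eventually (\<lambda>t. cosh (\<nu> * t) = eval_fps (bessel_fps \<nu>) (cosh t - 1) * cosh (t / 2)) (at_right 0)"
    unfolding eventually_at_right_field by (intro exI[of _ T]) auto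
  obtain B :: nat where B: "\<bar>\<nu>\<bar> \<le> real B" using real_arch_simple by blast
  have "\<bar>cosh (\<nu> * t)\<bar> \<le> 2 ^ B * cosh t ^ B" if "t \<ge> 0" for t
  proof -
    have "cosh (\<nu> * t) \<le> cosh (real B * t)"
    proof -
      have "\<bar>\<nu> * t\<bar> \<le> real B * t" using B that by (simp add: abs_mult mult_right_mono)
      hence "cosh \<bar>\<nu> * t\<bar> \<le> cosh (real B * t)"
        by (subst cosh_real_nonneg_le_iff) (use that in auto)
      thus ?thesis by simp
    qed
    also have "\<dots> \<le> exp (real B * t)"
      using that by (simp add: cosh_field_def)
    also have "\<dots> = exp t ^ B" by (simp add: exp_of_nat_mult)
    also have "\<dots> \<le> (2 * cosh t) ^ B"
      by (intro power_mono) (simp_all add: cosh_field_def)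
    finally show ?thesis by (simp add: power_mult_distrib)
  qed
  thus "\<exists>C (B::nat). \<forall>t\<ge>0. \<bar>cosh (\<nu> * t)\<bar> \<le> C * cosh t ^ B" by blast
qed

text \<open>
  Writing \<open>exp (- x * cosh t) = exp (- x) * exp (- x * (cosh t - 1))\<close> makes this an instance of Watson's
  lemma; by the normalization of \<open>bessel_fps\<close> the Gamma factors cancel.
\<close>

theorem Bessel_K_asymptotics:
  "\<exists>D. \<forall>x\<ge>1. \<bar>Bessel_K \<nu> x - (\<Sum>j<M. coeff_a \<nu> j * x powr (- real j - 1/2) * exp (- x))\<bar>
     \<le> D * x powr (- real M - 1/2) * exp (- x)"
proof -
  obtain D where D: "\<And>x. x \<ge> 1 \<Longrightarrow>
      set_integrable lborel {0..} (\<lambda>t. exp (- x * (cosh t - 1)) * cosh (\<nu> * t)) \<and>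
      \<bar>(LBINT t:{0..}. exp (- x * (cosh t - 1)) * cosh (\<nu> * t)) -
        (\<Sum>n<M. fps_nth (bessel_fps \<nu>) n * (Gamma (real n + 1/2) * x powr (- real n - 1/2) / sqrt 2))\<bar>
        \<le> D * x powr (- real M - 1/2)"
    using watson_hyperbolic[OF hyperbolic_expansion_cosh[of \<nu>], of M] by blast
  have "\<bar>Bessel_K \<nu> x - (\<Sum>j<M. coeff_a \<nu> j * x powr (- real j - 1/2) * exp (- x))\<bar>
     \<le> D * x powr (- real M - 1/2) * exp (- x)" if "x \<ge> 1" for x
  proof -
    have "exp (- x * cosh t) = exp (- x) * exp (- x * (cosh t - 1))" for t
      by (simp add: algebra_simps flip: exp_add)
    hence K: "Bessel_K \<nu> x = exp (- x) * (LBINT t:{0..}. exp (- x * (cosh t - 1)) * cosh (\<nu> * t))"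
      by (simp add: Bessel_K_def mult.assoc del: mult_minus_left)
    have coeff: "fps_nth (bessel_fps \<nu>) n * (Gamma (real n + 1/2) * x powr (- real n - 1/2) / sqrt 2)
        = coeff_a \<nu> n * x powr (- real n - 1/2)" for n
    proof -
      have "sqrt 2 * a / g * (g * p / sqrt 2) = a * p" if "g > 0" for a g p :: real
        using that by simp
      moreover have "Gamma (real n + 1/2) > 0" by (intro Gamma_real_pos) auto
      ultimately show ?thesis by (simp only: bessel_fps_def fps_nth_Abs_fps)
    qed
    have "Bessel_K \<nu> x - (\<Sum>j<M. coeff_a \<nu> j * x powr (- real j - 1/2) * exp (- x)) =
        exp (- x) * ((LBINT t:{0..}. exp (- x * (cosh t - 1)) * cosh (\<nu> * t)) -
          (\<Sum>j<M. coeff_a \<nu> j * x powr (- real j - 1/2)))"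
      by (simp add: K right_diff_distrib sum_distrib_left mult_ac)
    moreover have "\<bar>(LBINT t:{0..}. exp (- x * (cosh t - 1)) * cosh (\<nu> * t)) -
          (\<Sum>j<M. coeff_a \<nu> j * x powr (- real j - 1/2))\<bar> \<le> D * x powr (- real M - 1/2)"
      using D[OF that] by (simp only: coeff)
    ultimately show ?thesis by (simp add: abs_mult)
  qed
  thus ?thesis by blast
qed

section \<open>Power series of the weights\<close>

lemma taylor_coeff_eq_fps_nth:
  assumes "f has_fps_expansion P"
  shows "taylor_coeff f n = fps_nth P n"
proof -
  have "(deriv ^^ n) f has_fps_expansion (fps_deriv ^^ n) P"
    by (induction n) (auto intro: assms has_fps_expansion_deriv)
  hence "eventually (\<lambda>x. eval_fps ((fps_deriv ^^ n) P) x = (deriv ^^ n) f x) (nhds 0)"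
    unfolding has_fps_expansion_def by blast
  from eventually_nhds_x_imp_x[OF this]
  have "(deriv ^^ n) f 0 = eval_fps ((fps_deriv ^^ n) P) 0" by (rule sym)
  also have "\<dots> = fact n * fps_nth P n"
    by (simp add: eval_fps_at_0 fps_0th_higher_deriv)
  finally show ?thesis by (simp add: taylor_coeff_def)
qed

lemma has_fps_expansion_cong_nhds:
  assumes "f has_fps_expansion P" "eventually (\<lambda>x. f x = g x) (nhds 0)"
  shows "g has_fps_expansion P"
  using assms unfolding has_fps_expansion_def by (auto elim: eventually_elim2)

lemma has_fps_expansion_taylor_coeff:
  assumes "f has_fps_expansion P"
  shows "f has_fps_expansion Abs_fps (taylor_coeff f)"
proof -
  have "Abs_fps (taylor_coeff f) = P"
    by (rule fps_ext) (simp add: taylor_coeff_eq_fps_nth[OF assms])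
  thus ?thesis using assms by simp
qed

text \<open>
  The factor \<open>c\<close> covers both \<open>(1 + x) powr a\<close> and, with \<open>c = 1/2\<close>, the square roots of
  \<open>x + 2 = 2 * (1 + x/2)\<close>.
\<close>

lemma has_fps_expansion_powr_real:
  fixes a c :: real
  shows "(\<lambda>x. (1 + c * x) powr a) has_fps_expansion Abs_fps (\<lambda>n. (a gchoose n) * c ^ n)"
proof -
  let ?P = "Abs_fps (\<lambda>n. (a gchoose n) * c ^ n)"
  define d where "d = 1 / (\<bar>c\<bar> + 1)"
  have "d > 0" by (simp add: d_def add_nonneg_pos)
  have sums: "(\<lambda>n. fps_nth ?P n * x ^ n) sums (1 + c * x) powr a" if "\<bar>x\<bar> < d" for x
  proof -
    have "\<bar>c * x\<bar> \<le> \<bar>x\<bar> * (\<bar>c\<bar> + 1)" by (simp add: abs_mult algebra_simps)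
    also have "\<dots> < 1" using that by (simp add: d_def field_simps)
    finally have "\<bar>c * x\<bar> < 1" .
    from gen_binomial_real[OF this, of a] show ?thesis
      by (simp add: power_mult_distrib mult_ac)
  qed
  have "ereal (norm (d / 2)) \<le> fps_conv_radius ?P"
    unfolding fps_conv_radius_def
    by (rule conv_radius_geI, rule sums_summable, rule sums) (use \<open>d > 0\<close> in auto)
  moreover have "0 < ereal (norm (d / 2))"
    using \<open>d > 0\<close> by (simp add: zero_ereal_def)
  ultimately have "fps_conv_radius ?P > 0" by (rule less_le_trans[rotated])
  moreover have "eventually (\<lambda>x. eval_fps ?P x = (1 + c * x) powr a) (nhds 0)"
    unfolding eventually_nhds_metric
  proof (intro exI conjI allI impI)
    show "d > 0" by fact
    fix x :: real assume "dist x 0 < d"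
    hence "\<bar>x\<bar> < d" by simp
    from sums_unique[OF sums[OF this]] show "eval_fps ?P x = (1 + c * x) powr a"
      by (simp add: eval_fps_def)
  qed
  ultimately show ?thesis unfolding has_fps_expansion_def ..
qed

lemma has_fps_expansion_binomial_real:
  "(\<lambda>x::real. (1 + x) powr a) has_fps_expansion fps_binomial a"
proof -
  have "Abs_fps (\<lambda>n. (a gchoose n) * 1 ^ n) = fps_binomial a"
    by (rule fps_ext) simp
  thus ?thesis using has_fps_expansion_powr_real[of 1 a] by simp
qed

lemma has_fps_expansion_coeff_b:
  "(\<lambda>x. (x + 1) powr N / sqrt (x + 2)) has_fps_expansion Abs_fps (\<lambda>k. coeff_b k N)"
proof -
  have "eventually (\<lambda>x::real. x \<in> {-1<..}) (nhds 0)"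
    by (intro eventually_nhds_in_open) auto
  hence "eventually (\<lambda>x. (1 + x) powr N * (1 / sqrt 2 * (1 + 1/2 * x) powr (-1/2)) =
      (x + 1) powr N / sqrt (x + 2)) (nhds 0)"
  proof eventually_elim
    case (elim x)
    have "(1 + 1/2 * x) powr (-1/2) = 1 / sqrt ((x + 2) / 2)"
      using elim by (simp add: powr_minus powr_half_sqrt inverse_eq_divide field_simps)
    thus ?case by (simp add: real_sqrt_divide add.commute)
  qed
  with has_fps_expansion_mult[OF has_fps_expansion_binomial_real
      has_fps_expansion_cmult_left[OF has_fps_expansion_powr_real]]
  have "(\<lambda>x. (x + 1) powr N / sqrt (x + 2)) has_fps_expansion
      fps_binomial N * (fps_const (1 / sqrt 2) * Abs_fps (\<lambda>n. ((-1/2) gchoose n) * (1/2) ^ n))"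
    by (rule has_fps_expansion_cong_nhds)
  thus ?thesis unfolding coeff_b_def by (rule has_fps_expansion_taylor_coeff)
qed

lemma has_fps_expansion_coeff_d:
  "(\<lambda>x. sqrt (x + 2) * (x + 1) powr N) has_fps_expansion Abs_fps (\<lambda>k. coeff_d k N)"
proof -
  have "eventually (\<lambda>x::real. x \<in> {-1<..}) (nhds 0)"
    by (intro eventually_nhds_in_open) auto
  hence "eventually (\<lambda>x. (1 + x) powr N * (sqrt 2 * (1 + 1/2 * x) powr (1/2)) =
      sqrt (x + 2) * (x + 1) powr N) (nhds 0)"
  proof eventually_elim
    case (elim x)
    have "sqrt 2 * (1 + 1/2 * x) powr (1/2) = sqrt (2 * (1 + 1/2 * x))"
      using elim by (simp add: powr_half_sqrt flip: real_sqrt_mult)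
    thus ?case by (simp add: add.commute mult.commute)
  qed
  with has_fps_expansion_mult[OF has_fps_expansion_binomial_real
      has_fps_expansion_cmult_left[OF has_fps_expansion_powr_real]]
  have "(\<lambda>x. sqrt (x + 2) * (x + 1) powr N) has_fps_expansion
      fps_binomial N * (fps_const (sqrt 2) * Abs_fps (\<lambda>n. ((1/2) gchoose n) * (1/2) ^ n))"
    by (rule has_fps_expansion_cong_nhds)
  thus ?thesis unfolding coeff_d_def by (rule has_fps_expansion_taylor_coeff)
qed

lemma coeff_c_eq_gbinomial: "coeff_c l j = (- 1/2 - real j) gchoose l"
  by (simp add: coeff_c_def gbinomial_prod_rev atLeast0LessThan)

lemma filterlim_cosh_minus_1: "filterlim (\<lambda>t::real. cosh t - 1) (nhds 0) (at_right 0)"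
proof -
  have "((\<lambda>t::real. cosh t - 1) \<longlongrightarrow> cosh 0 - 1) (at_right 0)"
    by (intro tendsto_intros)
  thus ?thesis by simp
qed

lemma cosh_half_eq: "cosh (t / 2) = sqrt (cosh t + 1) / sqrt (2::real)"
proof -
  have "(cosh t + 1) / 2 = (cosh (t / 2))\<^sup>2"
    using cosh_double_cosh[of "t / 2"] by simp
  hence "sqrt ((cosh t + 1) / 2) = cosh (t / 2)" by simp
  thus ?thesis by (simp add: real_sqrt_divide)
qed

lemma cosh_powr_bound: "\<exists>B::nat. \<forall>t::real. cosh t powr a \<le> cosh t ^ B"
proof -
  obtain B :: nat where "a \<le> real B" using real_arch_simple by blast
  hence "cosh t powr a \<le> cosh t powr real B" for t :: real
    by (intro powr_mono cosh_real_ge_1)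
  thus ?thesis by (auto simp: powr_realpow)
qed

text \<open>
  By \<open>cosh (t/2) = sqrt (s + 2) / sqrt 2\<close>, dividing \<open>(1 + s) powr N\<close> by the half-angle factor gives
  \<open>sqrt 2\<close> times the function whose Taylor coefficients are \<open>coeff_b\<close>.
\<close>

lemma hyperbolic_expansion_cosh_powr:
  "hyperbolic_expansion (\<lambda>t. cosh t powr N) (fps_const (sqrt 2) * Abs_fps (\<lambda>k. coeff_b k N))"
  unfolding hyperbolic_expansion_def
proof (intro conjI)
  let ?Q = "fps_const (sqrt 2) * Abs_fps (\<lambda>k. coeff_b k N)"
  have Q: "(\<lambda>x. sqrt 2 * ((x + 1) powr N / sqrt (x + 2))) has_fps_expansion ?Q"
    by (intro has_fps_expansion_cmult_left has_fps_expansion_coeff_b)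
  thus "fps_conv_radius ?Q > 0" unfolding has_fps_expansion_def by blast
  show "(\<lambda>t::real. cosh t powr N) \<in> borel_measurable borel" by measurable
  show "\<exists>C (B::nat). \<forall>t\<ge>0. \<bar>cosh t powr N\<bar> \<le> C * cosh t ^ B"
    using cosh_powr_bound[of N] by (metis abs_of_nonneg mult_1 powr_ge_zero)
  from Q have "eventually (\<lambda>x. eval_fps ?Q x = sqrt 2 * ((x + 1) powr N / sqrt (x + 2))) (nhds 0)"
    unfolding has_fps_expansion_def by blast
  from eventually_compose_filterlim[OF this filterlim_cosh_minus_1]
  show "eventually (\<lambda>t. cosh t powr N = eval_fps ?Q (cosh t - 1) * cosh (t / 2)) (at_right 0)"
  proof eventually_elim
    case (elim t)
    have "cosh t + 1 > 0" using cosh_real_pos[of t] by linarith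
    with elim show ?case by (simp add: cosh_half_eq add.commute)
  qed
qed

text \<open>
  Here \<open>(sinh t)\<^sup>2 = s * (s + 2)\<close>, and dividing \<open>s + 2\<close> by the half-angle factor leaves
  \<open>sqrt 2 * sqrt (s + 2)\<close>; the factor \<open>s\<close> becomes \<open>fps_X\<close>.
\<close>

lemma hyperbolic_expansion_cosh_powr_sinh_sq:
  "hyperbolic_expansion (\<lambda>t. cosh t powr N * (sinh t)\<^sup>2)
     (fps_const (sqrt 2) * (fps_X * Abs_fps (\<lambda>k. coeff_d k N)))"
  unfolding hyperbolic_expansion_def
proof (intro conjI)
  let ?Q = "fps_const (sqrt 2) * (fps_X * Abs_fps (\<lambda>k. coeff_d k N))"
  have Q: "(\<lambda>x. sqrt 2 * (x * (sqrt (x + 2) * (x + 1) powr N))) has_fps_expansion ?Q"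
    by (intro has_fps_expansion_cmult_left has_fps_expansion_mult has_fps_expansion_fps_X
        has_fps_expansion_coeff_d)
  thus "fps_conv_radius ?Q > 0" unfolding has_fps_expansion_def by blast
  show "(\<lambda>t::real. cosh t powr N * (sinh t)\<^sup>2) \<in> borel_measurable borel" by measurable
  obtain B :: nat where B: "\<And>t::real. cosh t powr N \<le> cosh t ^ B"
    using cosh_powr_bound[of N] by blast
  have "\<bar>cosh t powr N * (sinh t)\<^sup>2\<bar> \<le> 1 * cosh t ^ (B + 2)" for t :: real
  proof -
    have "\<bar>cosh t powr N * (sinh t)\<^sup>2\<bar> = cosh t powr N * (sinh t)\<^sup>2" by simp
    also have "\<dots> \<le> cosh t ^ B * (cosh t)\<^sup>2"
      by (intro mult_mono B) (auto simp: cosh_square_eq)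
    finally show ?thesis by (simp add: power2_eq_square mult_ac)
  qed
  thus "\<exists>C (B::nat). \<forall>t\<ge>0. \<bar>cosh t powr N * (sinh t)\<^sup>2\<bar> \<le> C * cosh t ^ B" by blast
  from Q have "eventually (\<lambda>x. eval_fps ?Q x = sqrt 2 * (x * (sqrt (x + 2) * (x + 1) powr N))) (nhds 0)"
    unfolding has_fps_expansion_def by blast
  from eventually_compose_filterlim[OF this filterlim_cosh_minus_1]
  show "eventually (\<lambda>t. cosh t powr N * (sinh t)\<^sup>2 = eval_fps ?Q (cosh t - 1) * cosh (t / 2)) (at_right 0)"
  proof eventually_elim
    case (elim t)
    have pos: "cosh t + 1 > 0" using cosh_real_pos[of t] by linarith
    have "eval_fps ?Q (cosh t - 1) * cosh (t / 2) =
        (cosh t - 1) * (sqrt (cosh t + 1) * sqrt (cosh t + 1)) * cosh t powr N"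
      using elim by (simp add: cosh_half_eq add.commute)
    also have "\<dots> = cosh t powr N * (sinh t)\<^sup>2"
    proof -
      have "(sinh t)\<^sup>2 = (cosh t - 1) * (cosh t + 1)"
        using sinh_square_eq[of t] by (simp add: power2_eq_square algebra_simps)
      thus ?thesis using pos by (simp add: mult_ac)
    qed
    finally show ?case ..
  qed
qed

lemma hyperbolic_expansion_mult_cosh_powr:
  assumes "hyperbolic_expansion w Q"
  shows "hyperbolic_expansion (\<lambda>t. cosh t powr a * w t) (fps_binomial a * Q)"
  unfolding hyperbolic_expansion_def
proof (intro conjI)
  from assms obtain C and B :: nat where w [measurable]: "w \<in> borel_measurable borel"
    and growth: "\<And>t. t \<ge> 0 \<Longrightarrow> \<bar>w t\<bar> \<le> C * cosh t ^ B"
    and rad: "fps_conv_radius Q > 0"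
    and ev: "eventually (\<lambda>t. w t = eval_fps Q (cosh t - 1) * cosh (t / 2)) (at_right 0)"
    unfolding hyperbolic_expansion_def by blast
  have P: "(\<lambda>x. (1 + x) powr a * eval_fps Q x) has_fps_expansion fps_binomial a * Q"
    by (intro has_fps_expansion_mult has_fps_expansion_binomial_real eval_fps_has_fps_expansion rad)
  thus "fps_conv_radius (fps_binomial a * Q) > 0" unfolding has_fps_expansion_def by blast
  show "(\<lambda>t. cosh t powr a * w t) \<in> borel_measurable borel" by measurable
  obtain B' :: nat where B': "\<And>t::real. cosh t powr a \<le> cosh t ^ B'"
    using cosh_powr_bound[of a] by blast
  have "\<bar>cosh t powr a * w t\<bar> \<le> C * cosh t ^ (B' + B)" if "t \<ge> 0" for t
  proof -
    have "\<bar>cosh t powr a * w t\<bar> = cosh t powr a * \<bar>w t\<bar>" by (simp add: abs_mult)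
    also have "\<dots> \<le> cosh t ^ B' * (C * cosh t ^ B)"
      by (intro mult_mono B' growth that) auto
    finally show ?thesis by (simp add: power_add mult_ac)
  qed
  thus "\<exists>C (B::nat). \<forall>t\<ge>0. \<bar>cosh t powr a * w t\<bar> \<le> C * cosh t ^ B" by blast
  from P have "eventually (\<lambda>x. eval_fps (fps_binomial a * Q) x = (1 + x) powr a * eval_fps Q x) (nhds 0)"
    unfolding has_fps_expansion_def by blast
  from eventually_compose_filterlim[OF this filterlim_cosh_minus_1] ev
  show "eventually (\<lambda>t. cosh t powr a * w t =
      eval_fps (fps_binomial a * Q) (cosh t - 1) * cosh (t / 2)) (at_right 0)"
    by eventually_elim simp
qed

lemma sum_pairs_add_eq:
  fixes g :: "nat \<Rightarrow> nat \<Rightarrow> 'a :: comm_monoid_add"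
  shows "(\<Sum>(i, j)\<in>{(i, j). i + j = n}. g i j) = (\<Sum>i\<le>n. g i (n - i))"
  by (rule sum.reindex_bij_witness[of _ "\<lambda>i. (i, n - i)" fst]) auto

text \<open>
  Collecting by total degree \<open>s\<close> and truncating the \<open>j\<close>-th row at \<open>M - j\<close> describe the same triangle
  \<open>j + r < M\<close>.
\<close>

lemma sum_triangle:
  fixes g :: "nat \<Rightarrow> nat \<Rightarrow> 'a :: comm_monoid_add"
  shows "(\<Sum>s<M. \<Sum>(j, r)\<in>{(j, r). j + r = s}. g j r) = (\<Sum>j<M. \<Sum>r<M - j. g j r)"
proof -
  have "(\<Sum>j<M. \<Sum>r<M - j. g j r) = (\<Sum>(j, r)\<in>(SIGMA j:{..<M}. {..<M - j}). g j r)"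
    by (rule sum.Sigma) auto
  also have "(SIGMA j:{..<M}. {..<M - j}) = {(j, r). j + r < M}" by auto
  also have "(\<Sum>(j, r)\<in>{(j, r). j + r < M}. g j r) = (\<Sum>s<M. \<Sum>j\<le>s. g j (s - j))"
    by (rule sum.triangle_reindex)
  finally show ?thesis by (simp add: sum_pairs_add_eq)
qed

text \<open>
  Multiplying the weight by \<open>(1 + s) powr (- 1/2 - j)\<close> convolves its coefficients with \<open>coeff_c\<close>. The
  exponent \<open>m\<close> is the order of vanishing of the weight at \<open>s = 0\<close>.
\<close>

lemma fps_nth_binomial_weight:
  fixes q :: "real fps" and m :: nat
  defines "P \<equiv> \<lambda>j. fps_binomial (- 1/2 - real j) * (fps_const (sqrt 2) * (fps_X ^ m * q))"
  shows "n < m \<Longrightarrow> fps_nth (P j) n = 0"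
    and "fps_nth (P j) (r + m) = sqrt 2 * (\<Sum>(k, l)\<in>{(k, l). k + l = r}. fps_nth q k * coeff_c l j)"
proof -
  have P: "P j = fps_const (sqrt 2) * (fps_X ^ m * (q * fps_binomial (- 1/2 - real j)))"
    by (simp only: P_def mult_ac)
  show "n < m \<Longrightarrow> fps_nth (P j) n = 0"
    by (simp add: P fps_X_power_mult_nth)
  have "fps_nth (P j) (r + m) = sqrt 2 * (\<Sum>k\<le>r. fps_nth q k * coeff_c (r - k) j)"
  proof -
    have "fps_nth (P j) (r + m) = sqrt 2 * fps_nth (q * fps_binomial (- 1/2 - real j)) r"
      unfolding P by (simp only: fps_mult_left_const_nth fps_X_power_mult_nth) simp
    thus ?thesis by (simp only: fps_mult_nth fps_binomial_nth coeff_c_eq_gbinomial atLeast0AtMost)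
  qed
  thus "fps_nth (P j) (r + m) = sqrt 2 * (\<Sum>(k, l)\<in>{(k, l). k + l = r}. fps_nth q k * coeff_c l j)"
    by (simp add: sum_pairs_add_eq)
qed

text \<open>
  Watson's lemma at order \<open>K + m\<close>: the first \<open>m\<close> terms vanish, so that \<open>K\<close> terms remain. For \<open>K = 0\<close>
  it is the plain decay estimate \<open>z powr (- m - 1/2)\<close>.
\<close>

lemma weight_moment_asymptotics:
  fixes q :: "real fps"
  assumes "hyperbolic_expansion w (fps_const (sqrt 2) * (fps_X ^ m * q))"
  shows "\<exists>D. \<forall>z\<ge>1. set_integrable lborel {0..}
             (\<lambda>t. exp (- z * (cosh t - 1)) * (cosh t powr (- 1/2 - real j) * w t)) \<and>
           \<bar>(LBINT t:{0..}. exp (- z * (cosh t - 1)) * (cosh t powr (- 1/2 - real j) * w t)) -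
             (\<Sum>r<K. Gamma (real r + real m + 1/2) *
                (\<Sum>(k, l)\<in>{(k, l). k + l = r}. fps_nth q k * coeff_c l j) *
                z powr (- real r - real m - 1/2))\<bar>
             \<le> D * z powr (- real K - real m - 1/2)"
proof -
  let ?P = "fps_binomial (- 1/2 - real j) * (fps_const (sqrt 2) * (fps_X ^ m * q))"
  let ?T = "\<lambda>r. \<Sum>(k, l)\<in>{(k, l). k + l = r}. fps_nth q k * coeff_c l j"
  let ?h = "\<lambda>z n. fps_nth ?P n * (Gamma (real n + 1/2) * z powr (- real n - 1/2) / sqrt 2)"
  have sum_eq: "(\<Sum>n<K + m. ?h z n) =
      (\<Sum>r<K. Gamma (real r + real m + 1/2) * ?T r * z powr (- real r - real m - 1/2))" for z
  proof -
    have "(\<Sum>n<K + m. ?h z n) = (\<Sum>n\<in>{m..<K + m}. ?h z n)"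
    proof (rule sum.mono_neutral_right)
      have "?h z n = 0" if "n < m" for n
        unfolding fps_nth_binomial_weight(1)[OF that] by simp
      thus "\<forall>n\<in>{..<K + m} - {m..<K + m}. ?h z n = 0" by force
    qed auto
    also have "\<dots> = (\<Sum>r<K. ?h z (r + m))"
      using sum.shift_bounds_nat_ivl[of "?h z" 0 m K] by (simp add: atLeast0LessThan)
    also have "\<dots> = (\<Sum>r<K. Gamma (real r + real m + 1/2) * ?T r * z powr (- real r - real m - 1/2))"
    proof (rule sum.cong[OF refl])
      fix r
      have cancel: "sqrt 2 * x * (y * u / sqrt 2) = y * x * u" for x y u :: real by simp
      have "- real (r + m) - 1/2 = - real r - real m - 1/2" by simp
      thus "?h z (r + m) = Gamma (real r + real m + 1/2) * ?T r * z powr (- real r - real m - 1/2)"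
        unfolding fps_nth_binomial_weight(2) cancel by (simp only: of_nat_add)
    qed
    finally show ?thesis .
  qed
  have pw: "- real (K + m) - 1/2 = - real K - real m - 1/2" by simp
  show ?thesis
    using watson_hyperbolic[OF hyperbolic_expansion_mult_cosh_powr[OF assms], of "- 1/2 - real j" "K + m"]
    unfolding sum_eq pw .
qed

section \<open>Inserting the Bessel expansion under the integral\<close>

lemma borel_measurable_Bessel_K [measurable]: "Bessel_K \<nu> \<in> borel_measurable borel"
proof -
  have "(\<lambda>z. Bessel_K \<nu> z) \<in> borel_measurable borel"
    unfolding Bessel_K_def set_lebesgue_integral_def by measurable
  thus ?thesis by simp
qed

text \<open>
  The truncation error of the Bessel expansion at \<open>z * cosh t\<close> is again a weight times
  \<open>cosh t powr (- 1/2 - M)\<close>, so its integral is controlled by the decay of that weighted moment, at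
  the cost of the sign condition on \<open>w\<close>. The \<open>j\<close>-th term carries \<open>z powr (- j - 1/2)\<close>; expanding its
  moment to order \<open>M - j\<close> makes all errors of the same size \<open>z powr (- 1 - m - M)\<close>.
\<close>

theorem weighted_Bessel_K_asymptotics:
  fixes w :: "real \<Rightarrow> real" and q :: "real fps"
  assumes w: "hyperbolic_expansion w (fps_const (sqrt 2) * (fps_X ^ m * q))"
    and nonneg: "\<And>t. w t \<ge> 0"
  shows "(\<lambda>z. (LBINT t:{0..}. w t * Bessel_K \<nu> (z * cosh t)) - z powr (- 1 - real m) * exp (- z) *
            (\<Sum>s<M. (\<Sum>(j, r)\<in>{(j, r). j + r = s}. coeff_a \<nu> j * Gamma (real r + real m + 1/2) *
                (\<Sum>(k, l)\<in>{(k, l). k + l = r}. fps_nth q k * coeff_c l j)) * z powr (- real s)))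
          \<in> O[at_top](\<lambda>z. z powr (- 1 - real m - real M) * exp (- z))"
proof -
  define T where "T = (\<lambda>j r. \<Sum>(k, l)\<in>{(k, l). k + l = r}. fps_nth q k * coeff_c l j)"
  define f where "f = (\<lambda>j z t. exp (- z * (cosh t - 1)) * (cosh t powr (- 1/2 - real j) * w t))"
  define L where "L = (\<lambda>j z. LBINT t:{0..}. f j z t)"
  define S where "S = (\<lambda>j K z. \<Sum>r<K. Gamma (real r + real m + 1/2) * T j r *
                    z powr (- real r - real m - 1/2))"
  from w have w_meas [measurable]: "w \<in> borel_measurable borel"
    by (simp add: hyperbolic_expansion_def)
  have "\<exists>D. \<forall>z\<ge>1. set_integrable lborel {0..} (f j z) \<and>
      \<bar>L j z - S j K z\<bar> \<le> D * z powr (- real K - real m - 1/2)" for j K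
    unfolding L_def S_def T_def f_def by (rule weight_moment_asymptotics[OF w])
  then obtain D where D: "\<And>j K z. z \<ge> 1 \<Longrightarrow> set_integrable lborel {0..} (f j z) \<and>
      \<bar>L j z - S j K z\<bar> \<le> D j K * z powr (- real K - real m - 1/2)"
    by metis
  obtain E where E: "\<And>x. x \<ge> 1 \<Longrightarrow>
      \<bar>Bessel_K \<nu> x - (\<Sum>j<M. coeff_a \<nu> j * x powr (- real j - 1/2) * exp (- x))\<bar>
        \<le> E * x powr (- real M - 1/2) * exp (- x)"
    using Bessel_K_asymptotics[of \<nu> M] by blast
  define c where "c = (\<lambda>j z. coeff_a \<nu> j * (z powr (- real j - 1/2) * exp (- z)))"
  \<comment> \<open>\<open>E * D M 0\<close> pays for truncating the Bessel expansion, the sum for truncating the moments\<close>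
  define C where "C = E * D M 0 + (\<Sum>j<M. \<bar>coeff_a \<nu> j\<bar> * D j (M - j))"
  define main where "main = (\<lambda>z. z powr (- 1 - real m) * exp (- z) *
            (\<Sum>s<M. (\<Sum>(j, r)\<in>{(j, r). j + r = s}. coeff_a \<nu> j * Gamma (real r + real m + 1/2) * T j r)
               * z powr (- real s)))"
  have E_nonneg: "E \<ge> 0"
  proof -
    have "0 \<le> E * exp (-1)" using E[of 1] by (auto intro: order.trans[OF abs_ge_zero])
    thus ?thesis by (simp add: zero_le_mult_iff)
  qed

  have bound: "\<bar>(LBINT t:{0..}. w t * Bessel_K \<nu> (z * cosh t)) - main z\<bar>
      \<le> C * (z powr (- 1 - real m - real M) * exp (- z))" if z: "z \<ge> 1" for z
  proof -
    have pieces: "w t * ((z * cosh t) powr (- real j - 1/2) * exp (- (z * cosh t))) =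
        z powr (- real j - 1/2) * exp (- z) * f j z t" for j t
    proof -
      have "exp (- (z * cosh t)) = exp (- z) * exp (- z * (cosh t - 1))"
        by (simp add: algebra_simps flip: exp_add)
      moreover have "(z * cosh t) powr (- real j - 1/2) =
          z powr (- real j - 1/2) * cosh t powr (- 1/2 - real j)"
      proof -
        have "- 1/2 - real j = - real j - 1/2" by simp
        thus ?thesis using z by (simp only: powr_mult)
      qed
      ultimately show ?thesis by (simp add: f_def)
    qed
    \<comment> \<open>the integrand minus the first \<open>M\<close> terms of the Bessel expansion at \<open>z * cosh t\<close>\<close>
    define R where "R = (\<lambda>t. w t * Bessel_K \<nu> (z * cosh t) - (\<Sum>j<M. c j z * f j z t))"
    have R_bound: "\<bar>R t\<bar> \<le> E * (z powr (- real M - 1/2) * exp (- z)) * f M z t" for t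
    proof -
      let ?x = "z * cosh t"
      have x: "?x \<ge> 1" using mult_mono[OF z cosh_real_ge_1[of t]] z by simp
      have "c j z * f j z t = w t * (coeff_a \<nu> j * ?x powr (- real j - 1/2) * exp (- ?x))" for j
        using pieces[of t j] by (simp add: c_def mult_ac)
      hence "R t = w t * (Bessel_K \<nu> ?x - (\<Sum>j<M. coeff_a \<nu> j * ?x powr (- real j - 1/2) * exp (- ?x)))"
        by (simp add: R_def right_diff_distrib sum_distrib_left)
      hence "\<bar>R t\<bar> \<le> w t * (E * ?x powr (- real M - 1/2) * exp (- ?x))"
        using nonneg[of t] E[OF x] by (simp add: abs_mult mult_left_mono)
      also have "\<dots> = E * (z powr (- real M - 1/2) * exp (- z)) * f M z t"
        using pieces[of t M] by (simp add: mult_ac)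
      finally show ?thesis .
    qed
    have int_f: "set_integrable lborel {0..} (f j z)" for j using D[OF z] by blast
    have int_E: "set_integrable lborel {0..}
        (\<lambda>t. E * (z powr (- real M - 1/2) * exp (- z)) * f M z t)"
      by (intro set_integrable_mult_right int_f)
    have int_R: "set_integrable lborel {0..} R"
      using int_E
    proof (rule set_integrable_bound)
      show "set_borel_measurable lborel {0..} R"
        unfolding set_borel_measurable_def R_def f_def by measurable
      show "AE t in lborel. t \<in> {0..} \<longrightarrow>
          norm (R t) \<le> norm (E * (z powr (- real M - 1/2) * exp (- z)) * f M z t)"
        using R_bound by (intro AE_I2) (auto intro: order.trans[OF _ abs_ge_self])
    qed
    have int_sum: "set_integrable lborel {0..} (\<lambda>t. \<Sum>j<M. c j z * f j z t)"
      by (intro set_integral_sum_finite set_integrable_mult_right int_f)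
    have "(LBINT t:{0..}. w t * Bessel_K \<nu> (z * cosh t)) =
        (LBINT t:{0..}. (\<Sum>j<M. c j z * f j z t) + R t)"
      by (simp add: R_def)
    also have "\<dots> = (LBINT t:{0..}. (\<Sum>j<M. c j z * f j z t)) + (LBINT t:{0..}. R t)"
      by (intro set_integral_add int_sum int_R)
    also have "(LBINT t:{0..}. (\<Sum>j<M. c j z * f j z t)) = (\<Sum>j<M. c j z * L j z)"
      by (subst set_integral_sum_finite) (simp_all add: L_def set_integrable_mult_right int_f)
    finally have split: "(LBINT t:{0..}. w t * Bessel_K \<nu> (z * cosh t)) - (\<Sum>j<M. c j z * L j z) =
        (LBINT t:{0..}. R t)" by simp

    have "\<bar>LBINT t:{0..}. R t\<bar> \<le> (LBINT t:{0..}. \<bar>R t\<bar>)"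
      using set_integral_norm_bound[OF int_R] by simp
    also have "\<dots> \<le> (LBINT t:{0..}. E * (z powr (- real M - 1/2) * exp (- z)) * f M z t)"
      by (intro set_integral_mono set_integrable_abs int_R int_E R_bound)
    also have "\<dots> = E * (z powr (- real M - 1/2) * exp (- z)) * L M z"
      by (simp add: L_def)
    also have "\<dots> \<le> E * (z powr (- real M - 1/2) * exp (- z)) * (D M 0 * z powr (- real m - 1/2))"
      using D[OF z, of M 0] E_nonneg by (intro mult_left_mono) (simp_all add: S_def abs_le_iff)
    also have "\<dots> = E * D M 0 * (z powr (- 1 - real m - real M) * exp (- z))"
    proof -
      have "z powr (- real M - 1/2) * z powr (- real m - 1/2) = z powr (- 1 - real m - real M)"
        by (subst powr_add [symmetric], rule arg_cong [where f = "(powr) z"]) simp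
      thus ?thesis by simp
    qed
    finally have part1: "\<bar>(LBINT t:{0..}. w t * Bessel_K \<nu> (z * cosh t)) - (\<Sum>j<M. c j z * L j z)\<bar>
        \<le> E * D M 0 * (z powr (- 1 - real m - real M) * exp (- z))"
      unfolding split .

    have main_eq: "main z = (\<Sum>j<M. c j z * S j (M - j) z)"
    proof -
      let ?g = "\<lambda>j r. c j z * (Gamma (real r + real m + 1/2) * T j r * z powr (- real r - real m - 1/2))"
      have "main z = (\<Sum>s<M. \<Sum>(j, r)\<in>{(j, r). j + r = s}. ?g j r)"
        unfolding main_def sum_distrib_left sum_distrib_right
      proof (intro sum.cong refl, clarify)
        fix j r :: nat
        have "z powr (- 1 - real m) * z powr (- real (j + r)) =
            z powr (- real j - 1/2) * z powr (- real r - real m - 1/2)"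
          by (subst (1 2) powr_add [symmetric], rule arg_cong [where f = "(powr) z"]) simp
        hence "z powr (- 1 - real m) * exp (- z) * (x * y * u * z powr (- real (j + r))) =
            x * (z powr (- real j - 1/2) * exp (- z)) * (y * u * z powr (- real r - real m - 1/2))"
          for x y u by (simp add: mult_ac)
        thus "z powr (- 1 - real m) * exp (- z) * (coeff_a \<nu> j * Gamma (real r + real m + 1/2) * T j r *
            z powr (- real (j + r))) = ?g j r"
          by (simp only: c_def)
      qed
      also have "\<dots> = (\<Sum>j<M. \<Sum>r<M - j. ?g j r)" by (rule sum_triangle)
      finally show ?thesis by (simp only: S_def sum_distrib_left)
    qed

    have "\<bar>(\<Sum>j<M. c j z * L j z) - main z\<bar> = \<bar>\<Sum>j<M. c j z * (L j z - S j (M - j) z)\<bar>"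
      by (simp add: main_eq right_diff_distrib sum_subtractf)
    also have "\<dots> \<le> (\<Sum>j<M. \<bar>coeff_a \<nu> j\<bar> * D j (M - j) * (z powr (- 1 - real m - real M) * exp (- z)))"
    proof (rule order.trans[OF sum_abs sum_mono])
      fix j assume "j \<in> {..<M}"
      hence j: "real (M - j) = real M - real j" by simp
      have "\<bar>c j z * (L j z - S j (M - j) z)\<bar> \<le>
          \<bar>coeff_a \<nu> j\<bar> * (z powr (- real j - 1/2) * exp (- z)) *
            (D j (M - j) * z powr (- real (M - j) - real m - 1/2))"
        unfolding c_def abs_mult using D[OF z, of j "M - j"] by (intro mult_mono) auto
      also have "\<dots> = \<bar>coeff_a \<nu> j\<bar> * D j (M - j) * exp (- z) *
          (z powr (- real j - 1/2) * z powr (- real (M - j) - real m - 1/2))"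
        by (simp only: mult_ac)
      also have "z powr (- real j - 1/2) * z powr (- real (M - j) - real m - 1/2) =
          z powr (- 1 - real m - real M)"
        by (subst powr_add [symmetric], rule arg_cong [where f = "(powr) z"]) (simp add: j)
      finally show "\<bar>c j z * (L j z - S j (M - j) z)\<bar> \<le>
          \<bar>coeff_a \<nu> j\<bar> * D j (M - j) * (z powr (- 1 - real m - real M) * exp (- z))"
        by (simp only: mult_ac)
    qed
    finally have part2: "\<bar>(\<Sum>j<M. c j z * L j z) - main z\<bar> \<le>
        (\<Sum>j<M. \<bar>coeff_a \<nu> j\<bar> * D j (M - j)) * (z powr (- 1 - real m - real M) * exp (- z))"
      by (simp only: sum_distrib_right)
    from part1 part2 show ?thesis
      unfolding C_def distrib_right by linarith
  qed
  have "(\<lambda>z. (LBINT t:{0..}. w t * Bessel_K \<nu> (z * cosh t)) - main z)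
      \<in> O[at_top](\<lambda>z. z powr (- 1 - real m - real M) * exp (- z))"
  proof (rule bigoI[of _ C])
    show "eventually (\<lambda>z. norm ((LBINT t:{0..}. w t * Bessel_K \<nu> (z * cosh t)) - main z) \<le>
        C * norm (z powr (- 1 - real m - real M) * exp (- z))) at_top"
      using eventually_ge_at_top[of "1::real"] by eventually_elim (use bound in simp)
  qed
  thus ?thesis unfolding main_def T_def .
qed

theorem corollary2p5:
  fixes N \<nu> :: real and M :: nat
  assumes "M > 0"
  shows "((\<lambda>z. F \<nu> N z - z powr (-1) * exp (- z) *
            (\<Sum>s<M. (\<Sum>(j, r)\<in>{(j, r). j + r = s}. coeff_a \<nu> j * Gamma (real r + 1/2) *
                (\<Sum>(k, l)\<in>{(k, l). k + l = r}. coeff_b k N * coeff_c l j)) * z powr (- real s)))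
          \<in> O[at_top](\<lambda>z. z powr (- 1 - real M) * exp (- z)))
       \<and> ((\<lambda>z. G \<nu> N z - z powr (-2) * exp (- z) *
            (\<Sum>s<M. (\<Sum>(j, r)\<in>{(j, r). j + r = s}. coeff_a \<nu> j * Gamma (real r + 3/2) *
                (\<Sum>(k, l)\<in>{(k, l). k + l = r}. coeff_d k N * coeff_c l j)) * z powr (- real s)))
          \<in> O[at_top](\<lambda>z. z powr (- 2 - real M) * exp (- z)))"
proof
  have "hyperbolic_expansion (\<lambda>t. cosh t powr N)
      (fps_const (sqrt 2) * (fps_X ^ 0 * Abs_fps (\<lambda>k. coeff_b k N)))"
    using hyperbolic_expansion_cosh_powr[of N] by simp
  from weighted_Bessel_K_asymptotics[OF this, of \<nu> M]
  show "(\<lambda>z. F \<nu> N z - z powr (-1) * exp (- z) *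
            (\<Sum>s<M. (\<Sum>(j, r)\<in>{(j, r). j + r = s}. coeff_a \<nu> j * Gamma (real r + 1/2) *
                (\<Sum>(k, l)\<in>{(k, l). k + l = r}. coeff_b k N * coeff_c l j)) * z powr (- real s)))
          \<in> O[at_top](\<lambda>z. z powr (- 1 - real M) * exp (- z))"
    by (simp add: F_def)
next
  have "hyperbolic_expansion (\<lambda>t. cosh t powr N * (sinh t)\<^sup>2)
      (fps_const (sqrt 2) * (fps_X ^ 1 * Abs_fps (\<lambda>k. coeff_d k N)))"
    using hyperbolic_expansion_cosh_powr_sinh_sq[of N] by simp
  note asymp = weighted_Bessel_K_asymptotics[OF this, of \<nu> M]
  have Gamma_arg: "real r + real 1 + 1/2 = real r + 3/2" for r by simp
  have exps: "- 1 - real 1 = -2" "- 1 - real 1 - real M = - 2 - real M" by simp_all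
  have G: "G \<nu> N z = (LBINT t:{0..}. cosh t powr N * (sinh t)\<^sup>2 * Bessel_K \<nu> (z * cosh t))" for z
    unfolding G_def by (simp add: mult_ac)
  show "(\<lambda>z. G \<nu> N z - z powr (-2) * exp (- z) *
            (\<Sum>s<M. (\<Sum>(j, r)\<in>{(j, r). j + r = s}. coeff_a \<nu> j * Gamma (real r + 3/2) *
                (\<Sum>(k, l)\<in>{(k, l). k + l = r}. coeff_d k N * coeff_c l j)) * z powr (- real s)))
          \<in> O[at_top](\<lambda>z. z powr (- 2 - real M) * exp (- z))"
    using asymp unfolding Gamma_arg exps G fps_nth_Abs_fps by simp
qed

end
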